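(* Let $X$ be an $L$-embedded real Banach space with the Daugavet property and $\operatorname{dens}(X)=\omega_1$, and let $Y$ be a non-zero real Banach space. If either $X^{**}$ or $Y$ has the metric approximation property, then the projective tensor product $X\widehat{\otimes}_\pi Y$ has the Daugavet property.
   Context: All Banach spaces are real. $\operatorname{dens}(X)$ is the density character of $X$ and $\omega_1$ the first uncountable ordinal. A Banach space $X$ is $L$-embedded if there exists a subspace $Z$ of $X^{**}$ such that $X^{**}=X\oplus_1 Z$ (i.e. $X^{**}=X\oplus Z$ and $\Vert x+z\Vert=\Vert x\Vert+\Vert z\Vert$ for all $x\in X$, $z\in Z$). A Banach space $X$ has the Daugavet property if every rank-one operator $T:X\to X$ of the form $T(z)=x^*(z)x$, with $x\in X$ and $x^*\in X^*$, satisfies $\Vert T+I\Vert=1+\Vert T\Vert$, where $I$ is the identity operator. A Banach space $X$ has the metric approximation property if there exists a net of finite-rank norm-one operators $S_\alpha:X\to X$ such that $S_\alpha(x)\to x$ for all $x\in X$. $X\widehat{\otimes}_\pi Y$ denotes the (completed) projective tensor product. *)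

theory Defs
  imports "HOL-Analysis.Analysis"
begin

section \<open>A norming functional\<close>

text \<open>
  The Hahn--Banach theorem is needed only to see that the projective norm is definite.
  A partial linear functional dominated by the norm is represented by its graph, a subspace
  of \<open>'a \<times> real\<close> all of whose elements \<open>(v, r)\<close> satisfy \<open>r \<le> norm v\<close>.
\<close>

definition dominated_graph :: "('a::real_normed_vector \<times> real) set \<Rightarrow> bool"
  where "dominated_graph G \<longleftrightarrow> subspace G \<and> (\<forall>(v, r)\<in>G. r \<le> norm v)"

lemma dominated_graph_extend:
  fixes G :: "('a::real_normed_vector \<times> real) set"
  assumes G: "dominated_graph G"
  obtains c where "dominated_graph (span (insert (x0, c) G))"
proof -
  have sub: "subspace G" and dom: "\<And>v r. (v, r) \<in> G \<Longrightarrow> r \<le> norm v"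
    using G by (auto simp: dominated_graph_def)
  have G0: "(0, 0) \<in> G"
    using subspace_0[OF sub] by (simp add: zero_prod_def)
  have key: "r - norm (v - x0) \<le> norm (w + x0) - s" if "(v, r) \<in> G" "(w, s) \<in> G" for v r w s
  proof -
    have "(v + w, r + s) \<in> G"
      using subspace_add[OF sub that] by simp
    then have "r + s \<le> norm (v + w)"
      by (rule dom)
    also have "\<dots> = norm ((v - x0) + (w + x0))"
      by simp
    also have "\<dots> \<le> norm (v - x0) + norm (w + x0)"
      by (rule norm_triangle_ineq)
    finally show ?thesis
      by simp
  qed
  let ?L = "(\<lambda>(v, r). r - norm (v - x0)) ` G"
  define c where "c = Sup ?L"
  have bdd: "bdd_above ?L"
    using key[OF _ G0] by (intro bdd_aboveI[where M = "norm (0 + x0) - 0"]) auto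
  have lo: "r - norm (v - x0) \<le> c" if "(v, r) \<in> G" for v r
    unfolding c_def by (rule cSup_upper[OF _ bdd]) (use that in force)
  have hi: "c \<le> norm (w + x0) - s" if "(w, s) \<in> G" for w s
    unfolding c_def by (rule cSup_least) (use G0 key that in auto)
  have "r \<le> norm v" if vr: "(v, r) \<in> span (insert (x0, c) G)" for v r
  proof -
    obtain t where "(v, r) - t *\<^sub>R (x0, c) \<in> span G"
      using span_breakdown_eq[THEN iffD1, OF vr] by blast
    then have g: "(v - t *\<^sub>R x0, r - t * c) \<in> G"
      by (simp add: span_eq_iff[THEN iffD2, OF sub])
    have scaled: "((1 / a) *\<^sub>R (v - t *\<^sub>R x0), (r - t * c) / a) \<in> G" for a
      using subspace_scale[OF sub g, of "1 / a"] by simp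
    consider "t = 0" | "t > 0" | "t < 0"
      by linarith
    then show ?thesis
    proof cases
      case 1
      then show ?thesis
        using dom[OF g] by simp
    next
      case 2
      have e: "(1 / t) *\<^sub>R (v - t *\<^sub>R x0) + x0 = (1 / t) *\<^sub>R v"
        using 2 by (simp add: scaleR_diff_right)
      have "c \<le> norm ((1 / t) *\<^sub>R v) - (r - t * c) / t"
        using hi[OF scaled[of t]] unfolding e .
      then show ?thesis
        using 2 by (simp add: field_simps)
    next
      case 3
      have e: "(1 / (- t)) *\<^sub>R (v - t *\<^sub>R x0) - x0 = (1 / (- t)) *\<^sub>R v"
        using 3 by (simp add: scaleR_diff_right)
      have "(r - t * c) / (- t) - norm ((1 / (- t)) *\<^sub>R v) \<le> c"
        using lo[OF scaled[of "- t"]] unfolding e .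
      then show ?thesis
        using 3 by (simp add: field_simps)
    qed
  qed
  then have "dominated_graph (span (insert (x0, c) G))"
    by (auto simp: dominated_graph_def)
  then show thesis
    by (rule that)
qed

lemma norming_functional:
  fixes x :: "'a::real_normed_vector"
  obtains f :: "'a \<Rightarrow>\<^sub>L real" where "blinfun_apply f x = norm x" "norm f \<le> 1"
proof -
  let ?A = "{G. dominated_graph G \<and> (x, norm x) \<in> G}"
  have "\<exists>M\<in>?A. \<forall>G\<in>?A. M \<subseteq> G \<longrightarrow> G = M"
  proof (rule subset_Zorn_nonempty)
    have "dominated_graph (span {(x, norm x)})"
      unfolding dominated_graph_def
      by (intro conjI subspace_span) (auto simp: span_singleton mult_right_mono)
    then show "?A \<noteq> {}"
      using span_base by blast
  next
    fix C assume ne: "C \<noteq> {}" and ch: "subset.chain ?A C"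
    have 1: "\<And>G. G \<in> C \<Longrightarrow> subspace G \<and> (x, norm x) \<in> G \<and> (\<forall>(v, r)\<in>G. r \<le> norm v)"
      and 2: "\<And>G H. G \<in> C \<Longrightarrow> H \<in> C \<Longrightarrow> G \<subseteq> H \<or> H \<subseteq> G"
      using ch by (auto simp: subset.chain_def dominated_graph_def)
    have "subspace (\<Union>C)"
    proof (rule subspaceI)
      show "0 \<in> \<Union>C"
        using ne 1 subspace_0 by blast
      show "p + q \<in> \<Union>C" if "p \<in> \<Union>C" "q \<in> \<Union>C" for p q
      proof -
        obtain G H where "G \<in> C" "H \<in> C" "p \<in> G" "q \<in> H"
          using \<open>p \<in> \<Union>C\<close> \<open>q \<in> \<Union>C\<close> by blast
        then obtain K where "K \<in> C" "p \<in> K" "q \<in> K"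
          using 2[of G H] by blast
        then show ?thesis
          using 1 subspace_add[of K p q] by blast
      qed
      show "a *\<^sub>R p \<in> \<Union>C" if "p \<in> \<Union>C" for a p
        using that 1 subspace_scale by blast
    qed
    moreover have "(x, norm x) \<in> \<Union>C" "\<forall>(v, r)\<in>\<Union>C. r \<le> norm v"
      using ne 1 by blast+
    ultimately show "\<Union>C \<in> ?A"
      by (simp add: dominated_graph_def)
  qed
  then obtain M where M: "dominated_graph M" "(x, norm x) \<in> M"
    and max: "\<And>G. dominated_graph G \<Longrightarrow> (x, norm x) \<in> G \<Longrightarrow> M \<subseteq> G \<Longrightarrow> G = M"
    by blast
  have sub: "subspace M" and dom: "\<And>v r. (v, r) \<in> M \<Longrightarrow> r \<le> norm v"
    using M by (auto simp: dominated_graph_def)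
  have total: "\<exists>r. (v, r) \<in> M" for v
  proof -
    obtain c where c: "dominated_graph (span (insert (v, c) M))"
      using dominated_graph_extend[OF M(1)] by blast
    have "M \<subseteq> span (insert (v, c) M)" "(v, c) \<in> span (insert (v, c) M)"
      using span_superset[of "insert (v, c) M"] by auto
    then show ?thesis
      using max[OF c] M(2) by blast
  qed
  have unique: "r = s" if "(v, r) \<in> M" "(v, s) \<in> M" for v r s
    using dom[of 0 "r - s"] dom[of 0 "s - r"]
      subspace_diff[OF sub that] subspace_diff[OF sub that(2,1)] by simp
  define f where "f v = (THE r. (v, r) \<in> M)" for v
  have fM: "(v, f v) \<in> M" for v
    unfolding f_def by (rule theI') (use total unique in blast)
  have f_eq: "f v = r" if "(v, r) \<in> M" for v r
    using unique[OF fM that] .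
  have bl: "bounded_linear f"
  proof (rule bounded_linear_intro)
    show "f (v + w) = f v + f w" for v w
      using subspace_add[OF sub fM[of v] fM[of w]] by (intro f_eq) simp
    show "f (a *\<^sub>R v) = a *\<^sub>R f v" for a v
      using subspace_scale[OF sub fM[of v], of a] by (intro f_eq) simp
    show "norm (f v) \<le> norm v * 1" for v
      using dom[OF fM[of v]] dom[of "- v" "- f v"] subspace_neg[OF sub fM[of v]] by simp
  qed
  have bd: "norm (f v) \<le> 1 * norm v" for v
    using dom[OF fM[of v]] dom[of "- v" "- f v"] subspace_neg[OF sub fM[of v]] by simp
  show thesis
  proof (rule that[of "Blinfun f"])
    show "blinfun_apply (Blinfun f) x = norm x"
      by (simp add: bounded_linear_Blinfun_apply[OF bl] f_eq M(2))
    show "norm (Blinfun f) \<le> 1"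
      by (rule norm_blinfun_bound) (use bd in \<open>simp_all add: bounded_linear_Blinfun_apply[OF bl]\<close>)
  qed
qed


section \<open>The algebraic tensor product\<close>

text \<open>
  A list of pairs stands for the formal sum of the corresponding elementary tensors.  Two formal
  sums represent the same tensor iff every (not necessarily continuous) bilinear form takes the
  same value on both, i.e.\ tensors are regarded as linear functionals on the space of bilinear
  forms.
\<close>

definition eval_sum :: "('a::real_vector \<Rightarrow> 'b::real_vector \<Rightarrow> real) \<Rightarrow> ('a \<times> 'b) list \<Rightarrow> real"
  where "eval_sum A xs = (\<Sum>(x, y)\<leftarrow>xs. A x y)"

definition tensor_rel :: "('a::real_vector \<times> 'b::real_vector) list \<Rightarrow> ('a \<times> 'b) list \<Rightarrow> bool"
  where "tensor_rel xs ys \<longleftrightarrow> (\<forall>A. bilinear A \<longrightarrow> eval_sum A xs = eval_sum A ys)"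

lemma eval_sum_simps [simp]:
  "eval_sum A [] = 0"
  "eval_sum A ((x, y) # xs) = A x y + eval_sum A xs"
  "eval_sum A (xs @ ys) = eval_sum A xs + eval_sum A ys"
  by (simp_all add: eval_sum_def)

lemma eval_sum_scale:
  "bilinear A \<Longrightarrow> eval_sum A (map (map_prod (scaleR r) id) xs) = r * eval_sum A xs"
  by (induction xs) (auto simp: bilinear_lmul algebra_simps)

lemma eval_sum_minus:
  "bilinear A \<Longrightarrow> eval_sum A (map (map_prod uminus id) xs) = - eval_sum A xs"
  by (induction xs) (auto simp: bilinear_lneg)

quotient_type (overloaded) ('a, 'b) tensor =
    "('a::real_vector \<times> 'b::real_vector) list" / tensor_rel
  by (auto intro!: equivpI reflpI sympI transpI simp: tensor_rel_def)

instantiation tensor :: (real_vector, real_vector) real_vector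
begin

lift_definition zero_tensor :: "('a, 'b) tensor" is "[]" .

lift_definition plus_tensor :: "('a, 'b) tensor \<Rightarrow> ('a, 'b) tensor \<Rightarrow> ('a, 'b) tensor" is "(@)"
  by (simp add: tensor_rel_def)

lift_definition uminus_tensor :: "('a, 'b) tensor \<Rightarrow> ('a, 'b) tensor"
  is "map (map_prod uminus id)"
  by (simp add: tensor_rel_def eval_sum_minus)

lift_definition minus_tensor :: "('a, 'b) tensor \<Rightarrow> ('a, 'b) tensor \<Rightarrow> ('a, 'b) tensor"
  is "\<lambda>xs ys. xs @ map (map_prod uminus id) ys"
  by (simp add: tensor_rel_def eval_sum_minus)

lift_definition scaleR_tensor :: "real \<Rightarrow> ('a, 'b) tensor \<Rightarrow> ('a, 'b) tensor"
  is "\<lambda>r. map (map_prod (scaleR r) id)"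
  by (simp add: tensor_rel_def eval_sum_scale)

instance
proof
  fix u v w :: "('a, 'b) tensor" and r s :: real
  show "u + v + w = u + (v + w)"
    by transfer (simp add: tensor_rel_def)
  show "u + v = v + u"
    by transfer (simp add: tensor_rel_def)
  show "0 + u = u"
    by transfer (simp add: tensor_rel_def)
  show "- u + u = 0"
    by transfer (simp add: tensor_rel_def eval_sum_minus)
  show "u - v = u + - v"
    by transfer (simp add: tensor_rel_def)
  show "r *\<^sub>R (u + v) = r *\<^sub>R u + r *\<^sub>R v"
    by transfer (simp add: tensor_rel_def)
  show "(r + s) *\<^sub>R u = r *\<^sub>R u + s *\<^sub>R u"
    by transfer (simp add: tensor_rel_def eval_sum_scale distrib_right)
  show "r *\<^sub>R s *\<^sub>R u = (r * s) *\<^sub>R u"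
    by transfer (simp add: tensor_rel_def eval_sum_scale del: map_map)
  show "1 *\<^sub>R u = u"
    by transfer (simp add: tensor_rel_def eval_sum_scale)
qed

end

lift_definition elem_tensor :: "'a::real_vector \<Rightarrow> 'b::real_vector \<Rightarrow> ('a, 'b) tensor"
    (infixr \<open>\<otimes>\<^sub>t\<close> 75)
  is "\<lambda>x y. [(x, y)]" .

lemma abs_tensor_eq: "abs_tensor xs = (\<Sum>(x, y)\<leftarrow>xs. x \<otimes>\<^sub>t y)"
proof (induction xs)
  case Nil
  show ?case by (simp add: zero_tensor_def)
next
  case (Cons p xs)
  obtain x y where p: "p = (x, y)" by (cases p)
  have "abs_tensor (p # xs) = x \<otimes>\<^sub>t y + abs_tensor xs"
    by (simp add: p elem_tensor.abs_eq plus_tensor.abs_eq)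
  then show ?case by (simp add: Cons.IH p)
qed

lemma abs_tensor_exhaust:
  obtains xs where "u = abs_tensor xs"
proof -
  have "\<exists>xs. u = abs_tensor xs"
    by (rule tensor.abs_induct[of "\<lambda>v. \<exists>xs. v = abs_tensor xs"]) (rule exI, rule refl)
  then show thesis
    using that by blast
qed

lemma tensor_exhaust:
  obtains xs where "u = (\<Sum>(x, y)\<leftarrow>xs. x \<otimes>\<^sub>t y)"
  using abs_tensor_exhaust[of u] by (metis abs_tensor_eq)

lemma elem_tensor_sum_eq_iff:
  "(\<Sum>(x, y)\<leftarrow>xs. x \<otimes>\<^sub>t y) = (\<Sum>(x, y)\<leftarrow>ys. x \<otimes>\<^sub>t y) \<longleftrightarrow>
    (\<forall>A :: _ \<Rightarrow> _ \<Rightarrow> real. bilinear A \<longrightarrow>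
      (\<Sum>(x, y)\<leftarrow>xs. A x y) = (\<Sum>(x, y)\<leftarrow>ys. A x y))"
  by (simp add: abs_tensor_eq[symmetric] tensor.abs_eq_iff tensor_rel_def eval_sum_def)

lemma bilinear_elem_tensor: "bilinear (\<otimes>\<^sub>t)"
  unfolding bilinear_def
  by (intro conjI allI linearI; transfer; simp add: tensor_rel_def)
    (auto simp: bilinear_radd bilinear_ladd bilinear_rmul bilinear_lmul)


section \<open>The projective norm\<close>

definition proj_cost :: "('a::real_normed_vector \<times> 'b::real_normed_vector) list \<Rightarrow> real"
  where "proj_cost xs = (\<Sum>(x, y)\<leftarrow>xs. norm x * norm y)"

lemma proj_cost_simps [simp]:
  "proj_cost [] = 0"
  "proj_cost ((x, y) # xs) = norm x * norm y + proj_cost xs"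
  "proj_cost (xs @ ys) = proj_cost xs + proj_cost ys"
  by (simp_all add: proj_cost_def)

lemma proj_cost_nonneg: "0 \<le> proj_cost xs"
  by (induction xs) auto

lemma proj_cost_scale: "proj_cost (map (map_prod (scaleR r) id) xs) = \<bar>r\<bar> * proj_cost xs"
  by (induction xs) (auto simp: algebra_simps)

definition proj_norm :: "('a::real_normed_vector, 'b::real_normed_vector) tensor \<Rightarrow> real"
  where "proj_norm u =
    Inf {\<Sum>(x, y)\<leftarrow>xs. norm x * norm y | xs. u = (\<Sum>(x, y)\<leftarrow>xs. x \<otimes>\<^sub>t y)}"

lemma proj_norm_altdef: "proj_norm u = Inf {proj_cost xs | xs. u = abs_tensor xs}"
  by (simp add: proj_norm_def abs_tensor_eq proj_cost_def)

lemma proj_norm_le: "u = abs_tensor xs \<Longrightarrow> proj_norm u \<le> proj_cost xs"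
  unfolding proj_norm_altdef
  by (rule cInf_lower) (auto intro!: bdd_belowI[where m = 0] simp: proj_cost_nonneg)

lemma proj_norm_approx:
  assumes "e > 0"
  obtains xs where "u = abs_tensor xs" "proj_cost xs < proj_norm u + e"
proof -
  let ?S = "{proj_cost xs | xs. u = abs_tensor xs}"
  obtain xs where "u = abs_tensor xs"
    by (rule abs_tensor_exhaust)
  then have "?S \<noteq> {}"
    by blast
  moreover have "Inf ?S < proj_norm u + e"
    using assms by (simp add: proj_norm_altdef)
  ultimately show thesis
    using that cInf_lessD[of ?S] by blast
qed

lemma proj_norm_nonneg: "0 \<le> proj_norm u"
proof -
  obtain xs where "u = abs_tensor xs"
    by (rule abs_tensor_exhaust)
  then show ?thesis
    unfolding proj_norm_altdef by (intro cInf_greatest) (auto simp: proj_cost_nonneg)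
qed

lemma proj_norm_triangle: "proj_norm (u + v) \<le> proj_norm u + proj_norm v"
proof (rule field_le_epsilon)
  fix e :: real assume "e > 0"
  then obtain xs ys where xs: "u = abs_tensor xs" "proj_cost xs < proj_norm u + e / 2"
    and ys: "v = abs_tensor ys" "proj_cost ys < proj_norm v + e / 2"
    by (metis half_gt_zero proj_norm_approx)
  have "u + v = abs_tensor (xs @ ys)"
    by (simp add: xs ys plus_tensor.abs_eq)
  from proj_norm_le[OF this] show "proj_norm (u + v) \<le> proj_norm u + proj_norm v + e"
    using xs ys by simp
qed

lemma proj_norm_scale_le: "proj_norm (r *\<^sub>R u) \<le> \<bar>r\<bar> * proj_norm u"
proof (rule field_le_epsilon)
  fix e :: real assume e: "e > 0"
  define d where "d = e / (\<bar>r\<bar> + 1)"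
  have d: "d > 0" "\<bar>r\<bar> * d \<le> e"
    using e by (auto simp: d_def field_simps)
  obtain xs where xs: "u = abs_tensor xs" "proj_cost xs < proj_norm u + d"
    using proj_norm_approx[OF d(1)] by blast
  have "r *\<^sub>R u = abs_tensor (map (map_prod (scaleR r) id) xs)"
    by (simp add: xs scaleR_tensor.abs_eq)
  from proj_norm_le[OF this] have "proj_norm (r *\<^sub>R u) \<le> \<bar>r\<bar> * proj_cost xs"
    by (simp add: proj_cost_scale)
  also have "\<dots> \<le> \<bar>r\<bar> * (proj_norm u + d)"
    using xs by (intro mult_left_mono) auto
  finally show "proj_norm (r *\<^sub>R u) \<le> \<bar>r\<bar> * proj_norm u + e"
    using d by (simp add: algebra_simps)
qed

lemma proj_norm_zero: "proj_norm (0 :: ('a::real_normed_vector, 'b::real_normed_vector) tensor) = 0"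
  using proj_norm_le[of "0 :: ('a, 'b) tensor" "[]"] proj_norm_nonneg[of "0 :: ('a, 'b) tensor"]
  by (simp add: zero_tensor_def)

lemma proj_norm_scale: "proj_norm (r *\<^sub>R u) = \<bar>r\<bar> * proj_norm u"
proof (cases "r = 0")
  case True
  then show ?thesis by (simp add: proj_norm_zero)
next
  case False
  have "proj_norm u \<le> \<bar>inverse r\<bar> * proj_norm (r *\<^sub>R u)"
    using proj_norm_scale_le[of "inverse r" "r *\<^sub>R u"] False by simp
  then have "\<bar>r\<bar> * proj_norm u \<le> proj_norm (r *\<^sub>R u)"
    using False by (simp add: field_simps)
  then show ?thesis
    using proj_norm_scale_le[of r u] by simp
qed

text \<open>Definiteness: the forms \<open>f \<otimes> g\<close> with \<open>f\<close>, \<open>g\<close> bounded separate the points of the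
  algebraic tensor product.\<close>

lemma functionals_separate:
  fixes x :: "'a::real_normed_vector"
  assumes "\<And>f :: 'a \<Rightarrow>\<^sub>L real. blinfun_apply f x = 0"
  shows "x = 0"
  using norming_functional[of x] assms by (metis norm_eq_zero)

lemma bounded_eval_le_proj_norm:
  fixes f :: "'a::real_normed_vector \<Rightarrow>\<^sub>L real" and g :: "'b::real_normed_vector \<Rightarrow>\<^sub>L real"
  shows "\<bar>eval_sum (\<lambda>x y. f x * g y) xs\<bar> \<le> norm f * norm g * proj_cost xs"
proof (induction xs)
  case Nil
  show ?case by simp
next
  case (Cons p xs)
  obtain x y where p: "p = (x, y)" by (cases p)
  have "\<bar>f x * g y\<bar> \<le> (norm f * norm x) * (norm g * norm y)"
    unfolding abs_mult using norm_blinfun[of f x] norm_blinfun[of g y]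
    by (intro mult_mono) auto
  then show ?case
    using Cons.IH by (simp add: p algebra_simps)
qed

lemma bilinear_blinfun_mult:
  fixes f :: "'a::real_normed_vector \<Rightarrow>\<^sub>L real" and g :: "'b::real_normed_vector \<Rightarrow>\<^sub>L real"
  shows "bilinear (\<lambda>x y. f x * g y)"
  unfolding bilinear_def
  by (auto intro!: linearI simp: blinfun.add_right blinfun.scaleR_right algebra_simps)

lemma eval_sum_mult_left:
  fixes g :: "'b::real_normed_vector \<Rightarrow>\<^sub>L real"
  shows "eval_sum (\<lambda>x y. f x * g y) xs = g (\<Sum>(x, y)\<leftarrow>xs. f x *\<^sub>R y)"
  by (induction xs) (auto simp: blinfun.add_right blinfun.scaleR_right)

lemma tensor_eq_zeroI:
  fixes xs :: "('a::real_normed_vector \<times> 'b::real_vector) list"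
  assumes "\<And>f :: 'a \<Rightarrow>\<^sub>L real. (\<Sum>(x, y)\<leftarrow>xs. f x *\<^sub>R y) = 0" and "bilinear A"
  shows "eval_sum A xs = 0"
  using assms(1)
proof (induction "length xs" arbitrary: xs)
  case 0
  then show ?case by simp
next
  case (Suc n)
  obtain x y zs where xs: "xs = (x, y) # zs" and len: "length zs = n"
    using Suc.hyps(2) by (metis length_Suc_conv surj_pair)
  show ?case
  proof (cases "x = 0")
    case True
    then have "eval_sum A zs = 0"
      using Suc.prems xs by (intro Suc.hyps(1)) (auto simp: len)
    then show ?thesis
      using True \<open>bilinear A\<close> by (simp add: xs bilinear_lzero)
  next
    case False
    then obtain h :: "'a \<Rightarrow>\<^sub>L real" where h: "h x \<noteq> 0"
      using functionals_separate by blast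
    define c where "c z = - h z / h x" for z
    have y: "y = (\<Sum>(z, w)\<leftarrow>zs. c z *\<^sub>R w)"
    proof -
      have "h x *\<^sub>R y + (\<Sum>(z, w)\<leftarrow>zs. h z *\<^sub>R w) = 0"
        using Suc.prems[of h] by (simp add: xs)
      then have "h x *\<^sub>R y = - (\<Sum>(z, w)\<leftarrow>zs. h z *\<^sub>R w)"
        by (simp add: eq_neg_iff_add_eq_0)
      also have "\<dots> = h x *\<^sub>R (\<Sum>(z, w)\<leftarrow>zs. c z *\<^sub>R w)"
        using h by (induction zs) (auto simp: c_def scaleR_add_right)
      finally show ?thesis
        using h by simp
    qed
    define ws where "ws = map (\<lambda>(z, w). (z + c z *\<^sub>R x, w)) zs"
    have "(\<Sum>(z, w)\<leftarrow>ws. f z *\<^sub>R w) = f x *\<^sub>R (\<Sum>(z, w)\<leftarrow>zs. c z *\<^sub>R w) + (\<Sum>(z, w)\<leftarrow>zs. f z *\<^sub>R w)"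
      for f :: "'a \<Rightarrow>\<^sub>L real"
      unfolding ws_def
      by (induction zs)
        (auto simp: blinfun.add_right blinfun.scaleR_right scaleR_add_left scaleR_add_right ac_simps)
    then have "(\<Sum>(z, w)\<leftarrow>ws. f z *\<^sub>R w) = 0" for f :: "'a \<Rightarrow>\<^sub>L real"
      using Suc.prems[of f] by (simp add: xs flip: y)
    then have "eval_sum A ws = 0"
      by (intro Suc.hyps(1)) (simp_all add: ws_def len)
    moreover have "eval_sum A ws = A x (\<Sum>(z, w)\<leftarrow>zs. c z *\<^sub>R w) + eval_sum A zs"
      unfolding ws_def using \<open>bilinear A\<close>
      by (induction zs)
        (auto simp: bilinear_radd bilinear_ladd bilinear_rmul bilinear_lmul bilinear_rzero)
    ultimately show ?thesis
      by (simp add: xs flip: y)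
  qed
qed

lemma proj_norm_eq_0_imp:
  fixes u :: "('a::real_normed_vector, 'b::real_normed_vector) tensor"
  assumes "proj_norm u = 0"
  shows "u = 0"
proof -
  obtain xs where u: "u = abs_tensor xs"
    by (rule abs_tensor_exhaust)
  have *: "eval_sum (\<lambda>x y. f x * g y) xs = 0"
    for f :: "'a \<Rightarrow>\<^sub>L real" and g :: "'b \<Rightarrow>\<^sub>L real"
  proof -
    have "\<bar>eval_sum (\<lambda>x y. f x * g y) xs\<bar> \<le> 0 + e" if e: "e > 0" for e
    proof -
      define K where "K = norm f * norm g + 1"
      have K: "K > 0" "norm f * norm g \<le> K"
        by (auto simp: K_def intro: add_nonneg_pos)
      obtain ys where ys: "u = abs_tensor ys" "proj_cost ys < proj_norm u + e / K"
        using proj_norm_approx[of "e / K" u] e K by auto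
      have "eval_sum (\<lambda>x y. f x * g y) xs = eval_sum (\<lambda>x y. f x * g y) ys"
        using ys(1) u bilinear_blinfun_mult by (auto simp: tensor.abs_eq_iff tensor_rel_def)
      then have "\<bar>eval_sum (\<lambda>x y. f x * g y) xs\<bar> \<le> norm f * norm g * proj_cost ys"
        using bounded_eval_le_proj_norm by metis
      also have "\<dots> \<le> K * (e / K)"
        using ys(2) assms K proj_cost_nonneg[of ys] by (intro mult_mono) auto
      finally show ?thesis
        using K by simp
    qed
    then have "\<bar>eval_sum (\<lambda>x y. f x * g y) xs\<bar> \<le> 0"
      by (rule field_le_epsilon)
    then show ?thesis
      by simp
  qed
  have "(\<Sum>(x, y)\<leftarrow>xs. f x *\<^sub>R y) = 0" for f :: "'a \<Rightarrow>\<^sub>L real"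
  proof (rule functionals_separate)
    show "g (\<Sum>(x, y)\<leftarrow>xs. f x *\<^sub>R y) = 0" for g :: "'b \<Rightarrow>\<^sub>L real"
      using *[of f g] by (simp only: eval_sum_mult_left)
  qed
  then have "tensor_rel xs []"
    by (simp add: tensor_rel_def tensor_eq_zeroI)
  then show ?thesis
    by (simp add: u zero_tensor_def tensor.abs_eq_iff)
qed

instantiation tensor :: (real_normed_vector, real_normed_vector) real_normed_vector
begin

definition norm_tensor :: "('a, 'b) tensor \<Rightarrow> real"
  where "norm_tensor = proj_norm"

definition dist_tensor :: "('a, 'b) tensor \<Rightarrow> ('a, 'b) tensor \<Rightarrow> real"
  where "dist_tensor u v = norm (u - v)"

definition sgn_tensor :: "('a, 'b) tensor \<Rightarrow> ('a, 'b) tensor"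
  where "sgn_tensor u = inverse (norm u) *\<^sub>R u"

definition uniformity_tensor :: "(('a, 'b) tensor \<times> ('a, 'b) tensor) filter"
  where "uniformity_tensor = (INF e\<in>{0<..}. principal {(u, v). dist u v < e})"

definition open_tensor :: "('a, 'b) tensor set \<Rightarrow> bool"
  where "open_tensor U \<longleftrightarrow> (\<forall>u\<in>U. eventually (\<lambda>(u', v). u' = u \<longrightarrow> v \<in> U) uniformity)"

instance
proof
  fix u v :: "('a, 'b) tensor" and r :: real
  show "norm u = 0 \<longleftrightarrow> u = 0"
    using proj_norm_eq_0_imp proj_norm_zero by (auto simp: norm_tensor_def)
  show "norm (u + v) \<le> norm u + norm v"
    by (simp add: norm_tensor_def proj_norm_triangle)
  show "norm (r *\<^sub>R u) = \<bar>r\<bar> * norm u"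
    by (simp add: norm_tensor_def proj_norm_scale)
qed (simp_all only: dist_tensor_def sgn_tensor_def uniformity_tensor_def open_tensor_def)

end


section \<open>Completion of a normed space\<close>

definition completion_rel ::
    "(nat \<Rightarrow> 'a::real_normed_vector) \<Rightarrow> (nat \<Rightarrow> 'a) \<Rightarrow> bool"
  where "completion_rel X Y \<longleftrightarrow> Cauchy X \<and> Cauchy Y \<and> (\<lambda>n. X n - Y n) \<longlonglongrightarrow> 0"

lemma part_equivp_completion_rel:
  "part_equivp (completion_rel :: (nat \<Rightarrow> 'a::real_normed_vector) \<Rightarrow> _)" (is "part_equivp ?R")
proof (rule part_equivpI)
  show "\<exists>X. ?R X X"
    by (rule exI[of _ "\<lambda>_. 0"]) (auto simp: completion_rel_def Cauchy_def)
  show "symp ?R"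
  proof (rule sympI)
    fix X Y :: "nat \<Rightarrow> 'a"
    assume "completion_rel X Y"
    then show "completion_rel Y X"
      using tendsto_minus[of "\<lambda>n. X n - Y n" 0] by (auto simp: completion_rel_def)
  qed
  show "transp ?R"
  proof (rule transpI)
    fix X Y Z :: "nat \<Rightarrow> 'a"
    assume "completion_rel X Y" "completion_rel Y Z"
    then show "completion_rel X Z"
      using tendsto_add[of "\<lambda>n. X n - Y n" 0 _ "\<lambda>n. Y n - Z n" 0] by (auto simp: completion_rel_def)
  qed
qed

quotient_type (overloaded) 'a completion =
    "nat \<Rightarrow> 'a::real_normed_vector" / partial: completion_rel
  by (rule part_equivp_completion_rel)

lemma completion_rel_self [simp]: "completion_rel X X \<longleftrightarrow> Cauchy X"
  by (simp add: completion_rel_def)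

lemma Cauchy_minus_seq:
  fixes X :: "nat \<Rightarrow> 'a::real_normed_vector"
  shows "Cauchy X \<Longrightarrow> Cauchy (\<lambda>n. - X n)"
  by (simp add: Cauchy_def dist_minus)

lemma Cauchy_add_seq:
  fixes X Y :: "nat \<Rightarrow> 'a::real_normed_vector"
  assumes "Cauchy X" "Cauchy Y"
  shows "Cauchy (\<lambda>n. X n + Y n)"
proof (rule CauchyI)
  fix e :: real assume "e > 0"
  then obtain M N where M: "\<And>m n. m \<ge> M \<Longrightarrow> n \<ge> M \<Longrightarrow> norm (X m - X n) < e / 2"
    and N: "\<And>m n. m \<ge> N \<Longrightarrow> n \<ge> N \<Longrightarrow> norm (Y m - Y n) < e / 2"
    using assms CauchyD half_gt_zero by metis
  have "norm (X m + Y m - (X n + Y n)) < e" if "m \<ge> max M N" "n \<ge> max M N" for m n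
    using norm_diff_triangle_ineq[of "X m" "Y m" "X n" "Y n"] M[of m n] N[of m n] that by simp
  then show "\<exists>M. \<forall>m\<ge>M. \<forall>n\<ge>M. norm (X m + Y m - (X n + Y n)) < e"
    by blast
qed

lemma Cauchy_scaleR_seq:
  fixes X :: "nat \<Rightarrow> 'a::real_normed_vector"
  shows "Cauchy X \<Longrightarrow> Cauchy (\<lambda>n. r *\<^sub>R X n)"
  by (rule bounded_linear.Cauchy[OF bounded_linear_scaleR_right])

lemma Cauchy_norm_seq:
  fixes X :: "nat \<Rightarrow> 'a::real_normed_vector"
  assumes "Cauchy X"
  shows "convergent (\<lambda>n. norm (X n))"
proof -
  have "Cauchy (\<lambda>n. norm (X n))"
  proof (rule CauchyI)
    fix e :: real assume "e > 0"
    then obtain M where "\<And>m n. m \<ge> M \<Longrightarrow> n \<ge> M \<Longrightarrow> norm (X m - X n) < e"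
      using assms CauchyD by metis
    then show "\<exists>M. \<forall>m\<ge>M. \<forall>n\<ge>M. norm (norm (X m) - norm (X n)) < e"
      by (metis norm_triangle_ineq3 order_le_less_trans real_norm_def)
  qed
  then show ?thesis
    by (simp add: Cauchy_convergent_iff)
qed

lemma completion_rel_add:
  assumes "completion_rel X X'" "completion_rel Y Y'"
  shows "completion_rel (\<lambda>n. X n + Y n) (\<lambda>n. X' n + Y' n)"
  using assms tendsto_add[of "\<lambda>n. X n - X' n" 0 _ "\<lambda>n. Y n - Y' n" 0]
  by (auto simp: completion_rel_def Cauchy_add_seq algebra_simps)

lemma completion_rel_uminus:
  assumes "completion_rel X X'"
  shows "completion_rel (\<lambda>n. - X n) (\<lambda>n. - X' n)"
  using assms tendsto_minus[of "\<lambda>n. X n - X' n" 0]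
  by (auto simp: completion_rel_def Cauchy_minus_seq algebra_simps)

lemma completion_rel_scaleR:
  assumes "completion_rel X X'"
  shows "completion_rel (\<lambda>n. r *\<^sub>R X n) (\<lambda>n. r *\<^sub>R X' n)"
  using assms tendsto_scaleR[OF tendsto_const[of r], of "\<lambda>n. X n - X' n" 0]
  by (auto simp: completion_rel_def Cauchy_scaleR_seq algebra_simps)

lemma completion_rel_lim_norm:
  assumes "completion_rel X Y"
  shows "lim (\<lambda>n. norm (X n)) = lim (\<lambda>n. norm (Y n))"
proof -
  have "(\<lambda>n. X n - Y n) \<longlonglongrightarrow> 0"
    using assms by (simp add: completion_rel_def)
  then have "(\<lambda>n. norm (X n - Y n)) \<longlonglongrightarrow> 0"
    by (rule tendsto_norm_zero)
  then have "(\<lambda>n. norm (X n) - norm (Y n)) \<longlonglongrightarrow> 0"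
    by (rule Lim_null_comparison[rotated]) (simp add: norm_triangle_ineq3)
  moreover have "(\<lambda>n. norm (X n) - norm (Y n)) \<longlonglongrightarrow> lim (\<lambda>n. norm (X n)) - lim (\<lambda>n. norm (Y n))"
    using assms by (intro tendsto_diff)
      (auto simp: completion_rel_def Cauchy_norm_seq simp flip: convergent_LIMSEQ_iff)
  ultimately show ?thesis
    using LIMSEQ_unique by fastforce
qed

instantiation completion :: (real_normed_vector) real_normed_vector
begin

lift_definition zero_completion :: "'a completion" is "\<lambda>_. 0"
  by (simp add: Cauchy_def)

lift_definition plus_completion :: "'a completion \<Rightarrow> 'a completion \<Rightarrow> 'a completion"
  is "\<lambda>X Y n. X n + Y n"
  by (rule completion_rel_add)

lift_definition uminus_completion :: "'a completion \<Rightarrow> 'a completion"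
  is "\<lambda>X n. - X n"
  by (rule completion_rel_uminus)

lift_definition scaleR_completion :: "real \<Rightarrow> 'a completion \<Rightarrow> 'a completion"
  is "\<lambda>r X n. r *\<^sub>R X n"
  by (rule completion_rel_scaleR)

lift_definition norm_completion :: "'a completion \<Rightarrow> real"
  is "\<lambda>X. lim (\<lambda>n. norm (X n))"
  by (rule completion_rel_lim_norm)

definition minus_completion :: "'a completion \<Rightarrow> 'a completion \<Rightarrow> 'a completion"
  where "minus_completion u v = u + - v"

definition dist_completion :: "'a completion \<Rightarrow> 'a completion \<Rightarrow> real"
  where "dist_completion u v = norm (u - v)"

definition sgn_completion :: "'a completion \<Rightarrow> 'a completion"
  where "sgn_completion u = inverse (norm u) *\<^sub>R u"

definition uniformity_completion :: "('a completion \<times> 'a completion) filter"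
  where "uniformity_completion = (INF e\<in>{0<..}. principal {(u, v). dist u v < e})"

definition open_completion :: "'a completion set \<Rightarrow> bool"
  where "open_completion U \<longleftrightarrow> (\<forall>u\<in>U. eventually (\<lambda>(u', v). u' = u \<longrightarrow> v \<in> U) uniformity)"

instance
proof
  fix u v w :: "'a completion" and r s :: real
  show "u + v + w = u + (v + w)"
    by transfer (simp add: completion_rel_def Cauchy_add_seq algebra_simps)
  show "u + v = v + u"
    by transfer (simp add: completion_rel_def Cauchy_add_seq algebra_simps)
  show "0 + u = u"
    by transfer simp
  show "- u + u = 0"
    by transfer (simp add: completion_rel_def Cauchy_def)
  show "u - v = u + - v"
    by (rule minus_completion_def)
  show "r *\<^sub>R (u + v) = r *\<^sub>R u + r *\<^sub>R v"
    by transfer (simp add: completion_rel_def Cauchy_add_seq Cauchy_scaleR_seq algebra_simps)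
  show "(r + s) *\<^sub>R u = r *\<^sub>R u + s *\<^sub>R u"
    by transfer (simp add: completion_rel_def Cauchy_add_seq Cauchy_scaleR_seq algebra_simps)
  show "r *\<^sub>R s *\<^sub>R u = (r * s) *\<^sub>R u"
    by transfer (simp add: Cauchy_scaleR_seq)
  show "1 *\<^sub>R u = u"
    by transfer simp
  show "norm u = 0 \<longleftrightarrow> u = 0"
  proof transfer
    fix X :: "nat \<Rightarrow> 'a" assume "completion_rel X X"
    then have X: "Cauchy X" by simp
    then have "(\<lambda>n. norm (X n)) \<longlonglongrightarrow> lim (\<lambda>n. norm (X n))"
      using Cauchy_norm_seq convergent_LIMSEQ_iff by blast
    then have "lim (\<lambda>n. norm (X n)) = 0 \<longleftrightarrow> (\<lambda>n. norm (X n)) \<longlonglongrightarrow> 0"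
      using LIMSEQ_unique by (metis limI)
    also have "\<dots> \<longleftrightarrow> X \<longlonglongrightarrow> 0"
      by (rule tendsto_norm_zero_iff)
    finally show "lim (\<lambda>n. norm (X n)) = 0 \<longleftrightarrow> completion_rel X (\<lambda>_. 0)"
      using X by (simp add: completion_rel_def Cauchy_def)
  qed
  show "norm (u + v) \<le> norm u + norm v"
  proof transfer
    fix X Y :: "nat \<Rightarrow> 'a" assume "completion_rel X X" "completion_rel Y Y"
    then have lims: "(\<lambda>n. norm (X n + Y n)) \<longlonglongrightarrow> lim (\<lambda>n. norm (X n + Y n))"
      "(\<lambda>n. norm (X n)) \<longlonglongrightarrow> lim (\<lambda>n. norm (X n))" "(\<lambda>n. norm (Y n)) \<longlonglongrightarrow> lim (\<lambda>n. norm (Y n))"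
      by (auto simp: Cauchy_norm_seq Cauchy_add_seq simp flip: convergent_LIMSEQ_iff)
    show "lim (\<lambda>n. norm (X n + Y n)) \<le> lim (\<lambda>n. norm (X n)) + lim (\<lambda>n. norm (Y n))"
      by (rule LIMSEQ_le[OF lims(1) tendsto_add[OF lims(2,3)]]) (auto intro: norm_triangle_ineq)
  qed
  show "norm (r *\<^sub>R u) = \<bar>r\<bar> * norm u"
  proof transfer
    fix r :: real and X :: "nat \<Rightarrow> 'a" assume "completion_rel X X"
    then have "(\<lambda>n. norm (X n)) \<longlonglongrightarrow> lim (\<lambda>n. norm (X n))"
      using Cauchy_norm_seq convergent_LIMSEQ_iff by auto
    then have "(\<lambda>n. \<bar>r\<bar> * norm (X n)) \<longlonglongrightarrow> \<bar>r\<bar> * lim (\<lambda>n. norm (X n))"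
      by (rule tendsto_mult_left)
    then show "lim (\<lambda>n. norm (r *\<^sub>R X n)) = \<bar>r\<bar> * lim (\<lambda>n. norm (X n))"
      by (simp add: limI)
  qed
qed (simp_all only: dist_completion_def sgn_completion_def uniformity_completion_def
      open_completion_def)

end

lift_definition to_completion :: "'a::real_normed_vector \<Rightarrow> 'a completion" is "\<lambda>x _. x"
  by (simp add: Cauchy_def)

lemma norm_to_completion [simp]: "norm (to_completion x) = norm x"
  by transfer simp

lemma linear_to_completion: "linear to_completion"
  by (rule linearI; transfer) (simp_all add: Cauchy_def)

lemma dist_to_completion [simp]: "dist (to_completion x) (to_completion y) = dist x y"
  by (simp add: dist_norm flip: linear_diff[OF linear_to_completion])

lemma Cauchy_to_completion_limit:
  fixes X :: "nat \<Rightarrow> 'a::real_normed_vector"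
  assumes X: "Cauchy X"
  shows "(\<lambda>n. to_completion (X n)) \<longlonglongrightarrow> abs_completion X"
proof (rule LIMSEQ_I)
  fix e :: real assume "e > 0"
  then obtain N where N: "\<And>m n. m \<ge> N \<Longrightarrow> n \<ge> N \<Longrightarrow> norm (X m - X n) < e / 2"
    using CauchyD[OF X] half_gt_zero by metis
  have "norm (to_completion (X n) - abs_completion X) < e" if n: "n \<ge> N" for n
  proof -
    have C: "Cauchy (\<lambda>m. X n + - X m)"
      using X by (intro Cauchy_add_seq Cauchy_minus_seq) (auto simp: Cauchy_def)
    have "to_completion (X n) - abs_completion X = abs_completion (\<lambda>m. X n + - X m)"
      using X by (simp add: minus_completion_def to_completion.abs_eq uminus_completion.abs_eq
          plus_completion.abs_eq eq_onp_same_args Cauchy_minus_seq Cauchy_def[of "\<lambda>_. _"])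
    then have "norm (to_completion (X n) - abs_completion X) = lim (\<lambda>m. norm (X n + - X m))"
      using C by (simp add: norm_completion.abs_eq)
    also have "\<dots> \<le> e / 2"
    proof (rule LIMSEQ_le_const2)
      show "(\<lambda>m. norm (X n + - X m)) \<longlonglongrightarrow> lim (\<lambda>m. norm (X n + - X m))"
        using Cauchy_norm_seq[OF C] convergent_LIMSEQ_iff by blast
      show "\<exists>M. \<forall>m\<ge>M. norm (X n + - X m) \<le> e / 2"
        using N n by (auto intro!: exI[of _ N] less_imp_le)
    qed
    finally show ?thesis
      using \<open>e > 0\<close> by simp
  qed
  then show "\<exists>N. \<forall>n\<ge>N. norm (to_completion (X n) - abs_completion X) < e"
    by blast
qed

lemma completion_approx:
  assumes "e > 0"
  obtains x where "dist (to_completion x) u < e"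
proof -
  have "\<exists>X. Cauchy X \<and> u = abs_completion X"
    by (rule completion.abs_induct[of "\<lambda>v. \<exists>X. Cauchy X \<and> v = abs_completion X"]) auto
  then obtain X where "(\<lambda>n. to_completion (X n)) \<longlonglongrightarrow> u"
    using Cauchy_to_completion_limit by blast
  then obtain N where "\<And>n. n \<ge> N \<Longrightarrow> dist (to_completion (X n)) u < e"
    using metric_LIMSEQ_D[OF _ assms] by blast
  then show thesis
    using that by blast
qed

lemma closure_range_to_completion:
  "closure (range (to_completion :: 'a::real_normed_vector \<Rightarrow> _)) = UNIV"
proof -
  have "u \<in> closure (range to_completion)" for u :: "'a completion"
    unfolding closure_approachable by (metis completion_approx rangeI)
  then show ?thesis
    by blast
qed

instance completion :: (real_normed_vector) banach
proof
  fix U :: "nat \<Rightarrow> 'a completion"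
  assume U: "Cauchy U"
  have "\<exists>x. dist (to_completion x) (U n) < inverse (Suc n)" for n
    using completion_approx[of "inverse (real (Suc n))" "U n"] by auto
  then obtain X where X: "\<And>n. dist (to_completion (X n)) (U n) < inverse (Suc n)"
    by metis
  have XU: "(\<lambda>n. to_completion (X n) - U n) \<longlonglongrightarrow> 0"
    using X by (intro Lim_null_comparison[OF _ LIMSEQ_inverse_real_of_nat])
      (auto simp: dist_norm less_imp_le)
  have "Cauchy (\<lambda>n. U n + (to_completion (X n) - U n))"
    using Cauchy_add_seq[OF U LIMSEQ_imp_Cauchy[OF XU]] .
  then have "Cauchy X"
    by (simp add: Cauchy_def)
  from tendsto_diff[OF Cauchy_to_completion_limit[OF this] XU]
  show "convergent U"
    by (auto simp: convergent_def)
qed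

section \<open>Banach space notions\<close>

type_synonym ('a, 'b) projective_tensor = "('a, 'b) tensor completion"

type_synonym 'a dual = "'a \<Rightarrow>\<^sub>L real"

type_synonym 'a bidual = "('a \<Rightarrow>\<^sub>L real) \<Rightarrow>\<^sub>L real"

lift_definition canonical_embedding :: "'a::real_normed_vector \<Rightarrow> 'a bidual"
  is "\<lambda>x f. blinfun_apply f x"
  by (rule blinfun.bounded_linear_left)

definition L_embedded :: "'a::banach itself \<Rightarrow> bool"
  where "L_embedded _ \<longleftrightarrow>
    (\<exists>Z :: 'a bidual set. subspace Z \<and>
      range canonical_embedding \<inter> Z = {0} \<and>
      (\<forall>\<phi> :: 'a bidual. \<exists>x. \<exists>z\<in>Z. \<phi> = canonical_embedding x + z) \<and>
      (\<forall>x. \<forall>z\<in>Z. norm (canonical_embedding x + z) = norm x + norm z))"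

lift_definition rank_one :: "'a::real_normed_vector dual \<Rightarrow> 'b::real_normed_vector \<Rightarrow> 'a \<Rightarrow>\<^sub>L 'b"
  is "\<lambda>f x z. f z *\<^sub>R x"
  by (rule bounded_linear_compose[OF bounded_linear_scaleR_left])

definition Daugavet_property :: "'a::banach itself \<Rightarrow> bool"
  where "Daugavet_property _ \<longleftrightarrow>
    (\<forall>(f :: 'a dual) (x :: 'a). norm (rank_one f x + id_blinfun) = 1 + norm (rank_one f x))"

definition finite_rank :: "('a::real_normed_vector \<Rightarrow>\<^sub>L 'b::real_normed_vector) \<Rightarrow> bool"
  where "finite_rank S \<longleftrightarrow> (\<exists>B. finite B \<and> range (blinfun_apply S) \<subseteq> span B)"

text \<open>
  A net of operators is given by the filter generated by its tails on the space of operators.  (Conversely,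
  a proper filter \<open>F\<close> is the filter of tails of the net \<open>(P, S) \<mapsto> S\<close> indexed by the pairs with
  \<open>S \<in> P\<close> and \<open>P \<in> F\<close>, directed by reverse inclusion of \<open>P\<close>.)
\<close>

definition metric_approximation_property :: "'a::banach itself \<Rightarrow> bool"
  where "metric_approximation_property _ \<longleftrightarrow>
    (\<exists>F :: ('a \<Rightarrow>\<^sub>L 'a) filter. F \<noteq> bot \<and>
      (\<forall>\<^sub>F S in F. finite_rank S \<and> norm S = 1) \<and>
      (\<forall>x. ((\<lambda>S. blinfun_apply S x) \<longlongrightarrow> x) F))"

text \<open>The cardinal number \<open>\<kappa>\<close> is the least cardinality of a dense subset.\<close>

definition has_density_character :: "'a::topological_space itself \<Rightarrow> 'k rel \<Rightarrow> bool"
  where "has_density_character _ \<kappa> \<longleftrightarrow> Card_order \<kappa> \<and>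
    (\<exists>D :: 'a set. closure D = UNIV \<and> (card_of D, \<kappa>) \<in> ordIso) \<and>
    (\<forall>D :: 'a set. closure D = UNIV \<longrightarrow> (\<kappa>, card_of D) \<in> ordLeq)"

text \<open>The first uncountable cardinal, as a well-order (hence of order type \<open>\<omega>\<^sub>1\<close>).\<close>

definition omega_1 :: "nat set rel"
  where "omega_1 = cardSuc natLeq"

end

theory Submission
  imports Defs "HOL-Library.Countable_Set_Type"
begin

text \<open>
  The Daugavet property of a Banach space \<open>W\<close> is a statement about slices: for every functional
  \<open>G\<close>, every \<open>w\<close> and every \<open>e > 0\<close> there is \<open>t\<close> in the unit ball with \<open>G t \<ge> norm G - e\<close> and
  \<open>norm (w + t) \<ge> norm w + 1 - e\<close> (\<open>Daugavet_property_slice\<close> and \<open>Daugavet_property_if_slices\<close>).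
  For \<open>W\<close> the projective tensor product of \<open>X\<close> and \<open>Y\<close> such a \<open>t\<close> is found among the elementary
  tensors \<open>x \<otimes> y0\<close>. The vector \<open>y0\<close> is chosen first, so that \<open>f = G (\<cdot> \<otimes> y0)\<close> has almost the norm
  of \<open>G\<close>; then \<open>x\<close> is chosen close, in the weak-star topology, to a functional \<open>u\<close> in the unit
  ball of \<open>X**\<close> with \<open>u f = norm f\<close> which is almost orthogonal to \<open>X\<close> in the sense of \<open>\<ell>\<^sub>1\<close>:
  \<open>norm (x + u) \<ge> norm x + 1 - e\<close> for all \<open>x\<close> in \<open>X\<close>.

  Existence of \<open>u\<close> (\<open>almost_L_orthogonal\<close>). Almost orthogonality to a single \<open>x\<close> is witnessed by
  one functional \<open>h\<close> of norm at most \<open>1\<close> with \<open>h x + u h \<ge> norm x + 1 - e\<close>. Witnesses can be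
  collected one after the other along an enumeration of a dense set of order type \<open>\<omega>\<^sub>1\<close>, provided
  that any countable set of prescribed values \<open>u g\<close> can be kept while a witness for a new \<open>x\<close> is
  added. This is \<open>Daugavet_extension\<close>: one greedily picks \<open>x\<^sub>1, x\<^sub>2, \<dots>\<close> in the unit ball of \<open>X\<close>
  whose averages have the prescribed values as limits while \<open>norm (x + x\<^sub>1 + \<dots> + x\<^sub>n)\<close> stays almost
  maximal; a cluster point of the averages is the new \<open>u\<close> and a cluster point of functionals
  norming these sums is \<open>h\<close>. The density character enters here: proper initial segments of \<open>\<omega>\<^sub>1\<close>
  are countable, so that only countably many values are prescribed at each stage. Unions of chains
  of prescriptions can again be realized, by weak-star compactness.

  Use of \<open>u\<close> (\<open>weak_star_limit_estimate\<close>). Let \<open>z\<close> be a tensor and suppose that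
  \<open>norm (z + x \<otimes> y0) < c\<close> for all \<open>x\<close> along a filter converging weak-star to \<open>u\<close>. The
  approximation property of \<open>Y\<close>, or that of \<open>X**\<close> combined with the projection below, provides a
  form \<open>\<beta>(x, y) = \<Sum>i. s\<^sub>i x * g\<^sub>i y\<close> of norm at most \<open>1\<close> with \<open>\<beta> z\<close> almost equal to \<open>norm z\<close>. Only
  finitely many functionals on \<open>Y\<close> are involved, namely the \<open>g\<^sub>i\<close> and one functional \<open>h\<close> norming
  \<open>y0\<close>, so representations of \<open>z + x \<otimes> y0\<close> can be discretized with second factors from a fixed
  finite set and passed to a weak-star limit: \<open>z + u \<otimes> y0 = \<Sum>b. \<psi>\<^sub>b \<otimes> b\<close> with \<open>\<psi>\<^sub>b\<close> in \<open>X**\<close> and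
  \<open>\<Sum>b. norm \<psi>\<^sub>b \<le> c\<close>, as far as these functionals can see. Now the projection \<open>P\<close> of \<open>X**\<close> onto \<open>X\<close>
  given by the \<open>L\<close>-embedding splits this: \<open>\<beta>\<close> applied to the \<open>P\<close>-part shows
  \<open>\<beta> z - norm (P u) \<le> \<Sum>b. norm (P \<psi>\<^sub>b)\<close>, and \<open>h\<close> applied to the complementary part shows
  \<open>norm (u - P u) \<le> \<Sum>b. norm (\<psi>\<^sub>b - P \<psi>\<^sub>b)\<close>. The two right-hand sides add up to at most \<open>c\<close>, and
  \<open>norm (u - P u) - norm (P u) \<ge> 1 - e\<close> by the choice of \<open>u\<close>. Hence \<open>c\<close> is at least about
  \<open>norm z + 1\<close>.
\<close>

section \<open>Weak-star compactness\<close>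

text \<open>
  Compactness yields a cluster point of \<open>h\<close> along \<open>F\<close>; intersecting \<open>F\<close> with the preimages of its
  neighbourhoods gives a finer filter along which \<open>h\<close> converges. Finer filters take the place of
  subnets throughout.
\<close>

lemma compact_subfilter:
  assumes U: "compact U" and F: "F \<noteq> bot" and h: "\<forall>\<^sub>F t in F. h t \<in> U"
  obtains l F' where "l \<in> U" "F' \<noteq> bot" "F' \<le> F" "(h \<longlongrightarrow> l) F'"
proof -
  have "filtermap h F \<noteq> bot" "\<forall>\<^sub>F y in filtermap h F. y \<in> U"
    using F h by (auto simp: filtermap_bot_iff eventually_filtermap)
  then obtain l where l: "l \<in> U" "inf (nhds l) (filtermap h F) \<noteq> bot"
    using U unfolding compact_filter by blast
  define F' where "F' = inf F (filtercomap h (nhds l))"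
  have "F' \<noteq> bot"
  proof
    assume "F' = bot"
    then have "eventually (\<lambda>_. False) F'" by simp
    then obtain P Q where P: "eventually P F" and Q: "eventually Q (filtercomap h (nhds l))"
      and PQ: "\<And>t. P t \<Longrightarrow> Q t \<Longrightarrow> False"
      unfolding F'_def eventually_inf by blast
    obtain N where N: "eventually N (nhds l)" "\<And>t. N (h t) \<Longrightarrow> Q t"
      using Q unfolding eventually_filtercomap by blast
    have "eventually (\<lambda>y. \<not> N y) (filtermap h F)"
      unfolding eventually_filtermap using P by eventually_elim (use PQ N(2) in blast)
    then have "eventually (\<lambda>_. False) (inf (nhds l) (filtermap h F))"
      unfolding eventually_inf using N(1) by blast
    then show False
      using l(2) by (simp add: trivial_limit_def)
  qed
  moreover have "(h \<longlongrightarrow> l) F'"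
    unfolding F'_def by (rule filterlim_mono[OF filterlim_filtercomap order_refl]) simp
  ultimately show thesis
    using that l(1) F'_def by simp
qed

text \<open>
  The Banach--Alaoglu theorem in the form in which it is applied: a bounded net of functionals has
  a subnet that converges pointwise.
\<close>

lemma bounded_functionals_subfilter:
  fixes L :: "'t \<Rightarrow> 'a::real_normed_vector \<Rightarrow>\<^sub>L real"
  assumes F: "F \<noteq> bot" and C: "\<forall>\<^sub>F t in F. norm (L t) \<le> C"
  obtains F' l r where "F' \<noteq> bot" "F' \<le> F" "\<And>x. ((\<lambda>t. L t x) \<longlongrightarrow> blinfun_apply l x) F'"
    "((\<lambda>t. norm (L t)) \<longlongrightarrow> r) F'" "norm l \<le> r"
proof -
  let ?S = "\<lambda>x::'a. cball (0::real) (C * norm x)"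
  have "compactin (product_topology (\<lambda>_::'a. euclidean :: real topology) UNIV) (PiE UNIV ?S)"
    unfolding compactin_PiE by simp
  then have comp: "compact (PiE UNIV ?S)"
    by (simp add: euclidean_product_topology)
  have "\<forall>\<^sub>F t in F. blinfun_apply (L t) \<in> PiE UNIV ?S"
    using C
  proof eventually_elim
    case (elim t)
    have "\<bar>L t x\<bar> \<le> C * norm x" for x
      using norm_blinfun[of "L t" x] mult_right_mono[OF elim, of "norm x"] by simp
    then show ?case by auto
  qed
  \<comment> \<open>Tychonoff: the functionals eventually lie in a product of compact intervals.\<close>
  from compact_subfilter[OF comp F this]
  obtain l0 F1 where F1: "F1 \<noteq> bot" "F1 \<le> F" and l0: "((\<lambda>t. blinfun_apply (L t)) \<longlongrightarrow> l0) F1"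
    by blast
  \<comment> \<open>A second refinement makes the norms converge, so that the norm of the limit is bounded by
    their limit and not merely by \<open>C\<close>.\<close>
  have "\<forall>\<^sub>F t in F1. norm (L t) \<in> {0..C}"
    using filter_leD[OF F1(2) C] by eventually_elim simp
  from compact_subfilter[OF compact_Icc F1(1) this]
  obtain r F2 where F2: "F2 \<noteq> bot" "F2 \<le> F1" and r: "((\<lambda>t. norm (L t)) \<longlongrightarrow> r) F2"
    by blast
  have lim: "((\<lambda>t. L t x) \<longlongrightarrow> l0 x) F2" for x
  proof -
    have "((\<lambda>t. L t x) \<longlongrightarrow> l0 x) F1"
    proof (rule topological_tendstoI)
      fix S :: "real set" assume S: "open S" "l0 x \<in> S"
      have "open ((\<lambda>f::'a \<Rightarrow> real. f x) -` S)"
        by (rule open_vimage[OF S(1)]) simp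
      from topological_tendstoD[OF l0 this] show "\<forall>\<^sub>F t in F1. L t x \<in> S"
        using S(2) by simp
    qed
    then show ?thesis
      by (rule tendsto_mono[OF F2(2)])
  qed
  have bd: "\<bar>l0 x\<bar> \<le> r * norm x" for x
    by (rule tendsto_le[OF F2(1) tendsto_mult_right[OF r] tendsto_rabs[OF lim]])
      (simp add: norm_blinfun flip: real_norm_def)
  have bl: "bounded_linear l0"
  proof (rule bounded_linear_intro)
    show "l0 (x + y) = l0 x + l0 y" for x y
      by (rule tendsto_unique[OF F2(1) lim])
        (use tendsto_add[OF lim[of x] lim[of y]] in \<open>simp add: blinfun.add_right\<close>)
    show "l0 (a *\<^sub>R x) = a *\<^sub>R l0 x" for a x
      by (rule tendsto_unique[OF F2(1) lim])
        (use tendsto_mult_left[OF lim[of x], of a] in \<open>simp add: blinfun.scaleR_right\<close>)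
    show "norm (l0 x) \<le> norm x * r" for x
      using bd[of x] by (simp add: mult.commute)
  qed
  show thesis
  proof (rule that[of F2 "Blinfun l0" r])
    show "((\<lambda>t. L t x) \<longlongrightarrow> Blinfun l0 x) F2" for x
      using lim by (simp add: bounded_linear_Blinfun_apply[OF bl])
    have "r \<ge> 0"
      by (rule tendsto_lowerbound[OF r _ F2(1)]) simp
    then show "norm (Blinfun l0) \<le> r"
      by (intro norm_blinfun_bound) (use bd in \<open>auto simp: bounded_linear_Blinfun_apply[OF bl]\<close>)
  qed (use F1 F2 r in auto)
qed

lemma canonical_embedding_apply [simp]: "blinfun_apply (canonical_embedding x) f = blinfun_apply f x"
  by (simp add: canonical_embedding.rep_eq)

lemma linear_canonical_embedding: "linear canonical_embedding"
  by (rule linearI; rule blinfun_eqI)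
    (simp_all add: blinfun.add_right blinfun.add_left blinfun.scaleR_left blinfun.scaleR_right)

lemma norm_canonical_embedding [simp]: "norm (canonical_embedding x) = norm x"
proof (rule antisym)
  show "norm (canonical_embedding x) \<le> norm x"
    by (rule norm_blinfun_bound) (simp_all add: norm_blinfun mult.commute[of "norm x"] del: real_norm_def)
  obtain f :: "'a \<Rightarrow>\<^sub>L real" where f: "f x = norm x" "norm f \<le> 1"
    by (rule norming_functional)
  have "norm x \<le> norm (canonical_embedding x) * norm f"
    using norm_blinfun[of "canonical_embedding x" f] f(1) by simp
  also have "\<dots> \<le> norm (canonical_embedding x) * 1"
    using f(2) by (intro mult_left_mono) auto
  finally show "norm x \<le> norm (canonical_embedding x)" by simp
qed

text \<open>
  Finitely many bounded nets in \<open>X\<close> converge weak-star in \<open>X**\<close> along a common subnet.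
\<close>

lemma bounded_family_subfilter:
  fixes v :: "'t \<Rightarrow> 'i \<Rightarrow> 'a::real_normed_vector"
  assumes "finite N" "F \<noteq> bot" "\<And>i. i \<in> N \<Longrightarrow> \<forall>\<^sub>F t in F. norm (v t i) \<le> C"
  obtains F' and \<psi> :: "'i \<Rightarrow> 'a bidual" and r where "F' \<noteq> bot" "F' \<le> F"
    "\<And>i f. i \<in> N \<Longrightarrow> ((\<lambda>t. blinfun_apply f (v t i)) \<longlongrightarrow> \<psi> i f) F'"
    "\<And>i. i \<in> N \<Longrightarrow> ((\<lambda>t. norm (v t i)) \<longlongrightarrow> r i) F'" "\<And>i. i \<in> N \<Longrightarrow> norm (\<psi> i) \<le> r i"
proof -
  have "\<exists>F' (\<psi> :: 'i \<Rightarrow> 'a bidual) (r :: 'i \<Rightarrow> real). F' \<noteq> bot \<and> F' \<le> F \<and> (\<forall>i\<in>N.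
      (\<forall>f. ((\<lambda>t. blinfun_apply f (v t i)) \<longlongrightarrow> blinfun_apply (\<psi> i) f) F') \<and> ((\<lambda>t. norm (v t i)) \<longlongrightarrow> r i) F' \<and> norm (\<psi> i) \<le> r i)"
    using assms
  proof (induction N)
    case empty
    then show ?case by auto
  next
    case (insert j N)
    then obtain F1 and \<psi> :: "'i \<Rightarrow> 'a bidual" and r where F1: "F1 \<noteq> bot" "F1 \<le> F"
      and IH: "\<And>i f. i \<in> N \<Longrightarrow> ((\<lambda>t. blinfun_apply f (v t i)) \<longlongrightarrow> \<psi> i f) F1"
        "\<And>i. i \<in> N \<Longrightarrow> ((\<lambda>t. norm (v t i)) \<longlongrightarrow> r i) F1" "\<And>i. i \<in> N \<Longrightarrow> norm (\<psi> i) \<le> r i"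
      by (metis insertCI)
    have "\<forall>\<^sub>F t in F1. norm (canonical_embedding (v t j)) \<le> C"
      using filter_leD[OF F1(2) insert.prems(2)[of j]] by simp
    from bounded_functionals_subfilter[OF F1(1) this] obtain F2 l q where F2: "F2 \<noteq> bot" "F2 \<le> F1"
      and l: "\<And>f. ((\<lambda>t. canonical_embedding (v t j) f) \<longlongrightarrow> blinfun_apply l f) F2"
      and q: "((\<lambda>t. norm (canonical_embedding (v t j))) \<longlongrightarrow> q) F2" "norm l \<le> q" by blast
    show ?case
      by (rule exI[of _ F2], rule exI[of _ "\<psi>(j := l)"], rule exI[of _ "r(j := q)"])
        (use F1 F2 l q IH in \<open>auto intro: tendsto_mono[OF F2(2)]\<close>)
  qed
  then show thesis using that by metis
qed

section \<open>The Daugavet property and slices\<close>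

lemma functional_norming_vector:
  fixes g :: "'a::real_normed_vector \<Rightarrow>\<^sub>L real"
  assumes "0 \<le> c" "c < norm g"
  obtains x where "norm x = 1" "c < g x"
proof -
  obtain z where z: "c * norm z < norm (g z)"
    using norm_blinfun_bound[OF assms(1), of g] assms(2) by (metis not_le)
  then have "z \<noteq> 0" by auto
  define x where "x = (sgn (g z) / norm z) *\<^sub>R z"
  have "g z \<noteq> 0" using z assms(1) by (metis abs_zero mult_nonneg_nonneg norm_ge_zero not_le real_norm_def)
  then have "norm x = 1"
    using \<open>z \<noteq> 0\<close> by (simp add: x_def sgn_if)
  moreover have "g x = \<bar>g z\<bar> / norm z"
    by (simp add: x_def blinfun.scaleR_right abs_sgn mult.commute)
  then have "c < g x"
    using z \<open>z \<noteq> 0\<close> by (simp add: pos_less_divide_eq)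
  ultimately show thesis by (rule that)
qed

lemma rank_one_apply [simp]: "blinfun_apply (rank_one f x) z = f z *\<^sub>R x"
  by (simp add: rank_one.rep_eq)

lemma norm_rank_one: "norm (rank_one f x) = norm f * norm x"
proof (rule antisym)
  show "norm (rank_one f x) \<le> norm f * norm x"
    by (rule norm_blinfun_bound)
      (use mult_right_mono[OF norm_blinfun[of f], of "norm x"] in \<open>auto simp: algebra_simps\<close>)
  show "norm f * norm x \<le> norm (rank_one f x)"
  proof (cases "x = 0")
    case False
    have "norm f \<le> norm (rank_one f x) / norm x"
      by (rule norm_blinfun_bound)
        (use norm_blinfun[of "rank_one f x"] False in \<open>auto simp: field_simps\<close>)
    then show ?thesis using False by (simp add: field_simps)
  qed simp
qed

text \<open>
  If \<open>f\<close> almost attains its norm at \<open>x\<close>, then \<open>f \<otimes> y + I\<close> maps \<open>x\<close> almost to \<open>norm f *\<^sub>R y + x\<close>.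
  The slice condition for \<open>norm f *\<^sub>R y\<close> makes this vector almost as long as possible.
\<close>

lemma Daugavet_property_if_slices:
  assumes slices: "\<And>(g :: 'a::banach dual) (y :: 'a) e. e > 0 \<Longrightarrow>
    \<exists>x. norm x \<le> 1 \<and> norm g - e \<le> blinfun_apply g x \<and> norm y + 1 - e \<le> norm (y + x)"
  shows "Daugavet_property TYPE('a)"
  unfolding Daugavet_property_def
proof (intro allI antisym)
  fix f :: "'a dual" and y :: 'a
  have "norm (rank_one f y + id_blinfun) \<le> norm (rank_one f y) + norm (id_blinfun :: 'a \<Rightarrow>\<^sub>L 'a)"
    by (rule norm_triangle_ineq)
  also have "norm (id_blinfun :: 'a \<Rightarrow>\<^sub>L 'a) \<le> 1"
    by (rule norm_blinfun_bound) auto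
  finally show "norm (rank_one f y + id_blinfun) \<le> 1 + norm (rank_one f y)"
    by simp
  show "1 + norm (rank_one f y) \<le> norm (rank_one f y + id_blinfun)"
  proof (rule field_le_epsilon)
    fix e :: real assume "e > 0"
    define d where "d = e / (1 + norm y)"
    have d: "d > 0" "d * (1 + norm y) = e"
      using \<open>e > 0\<close> by (auto simp: d_def add_pos_nonneg field_simps add_nonneg_eq_0_iff)
    obtain x where x: "norm x \<le> 1" "norm f - d \<le> f x"
      and yx: "norm (norm f *\<^sub>R y) + 1 - d \<le> norm (norm f *\<^sub>R y + x)"
      using slices[OF d(1)] by blast
    have fx: "\<bar>norm f - f x\<bar> \<le> d"
      using x norm_blinfun[of f x] mult_left_mono[OF x(1), of "norm f"] by auto
    have "norm (norm f *\<^sub>R y + x) \<le> norm (f x *\<^sub>R y + x) + norm ((norm f - f x) *\<^sub>R y)"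
      by (rule order_trans[OF _ norm_triangle_ineq]) (simp add: algebra_simps)
    also have "norm ((norm f - f x) *\<^sub>R y) \<le> d * norm y"
      using fx by (simp add: mult_right_mono)
    also have "norm (f x *\<^sub>R y + x) \<le> norm (rank_one f y + id_blinfun) * norm x"
      using norm_blinfun[of "rank_one f y + id_blinfun" x] by (simp add: blinfun.add_left)
    also have "\<dots> \<le> norm (rank_one f y + id_blinfun)"
      using mult_left_mono[OF x(1), of "norm (rank_one f y + id_blinfun)"] by simp
    finally show "1 + norm (rank_one f y) \<le> norm (rank_one f y + id_blinfun) + e"
      using yx d(2) by (simp add: norm_rank_one algebra_simps)
  qed
qed

text \<open>
  The converse implication; the zero space has to be excluded because its unit ball contains no
  vectors of norm close to \<open>1\<close>.
\<close>

lemma Daugavet_property_slice: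
  fixes g :: "'a::banach dual" and y x0 :: 'a
  assumes D: "Daugavet_property TYPE('a)" and x0: "x0 \<noteq> 0" and e: "e > 0"
  obtains x where "norm x \<le> 1" "norm g - e \<le> g x" "norm y + 1 - e \<le> norm (y + x)"
proof -
  have main: "\<exists>x. norm x \<le> 1 \<and> norm g - e \<le> g x \<and> norm y + 1 - e \<le> norm (y + x)"
    if g: "g \<noteq> 0" and y: "y \<noteq> 0" for g :: "'a dual" and y :: 'a
  proof -
    define G where "G = (1 / norm g) *\<^sub>R g"
    have G: "norm G = 1" "\<And>x. g x = norm g * G x"
      using g by (auto simp: G_def blinfun.scaleR_left)
    define d where "d = min (e / 2) (min (norm y * e / norm g) 1)"
    have "d > 0" unfolding d_def using e g y by auto
    moreover have "d \<le> e / 2" "d \<le> norm y * e / norm g" "d \<le> 1"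
      unfolding d_def by (meson min.cobounded1 min.cobounded2 order_trans)+
    ultimately have d: "d > 0" "2 * d \<le> e" "norm g * d \<le> norm y * e" "d \<le> 1"
      using g by (simp_all add: pos_le_divide_eq mult.commute)
    \<comment> \<open>A vector \<open>z\<close> at which \<open>G \<otimes> y + I\<close> almost attains its norm has, up to sign, \<open>G z\<close> close to
      \<open>1\<close>, so that \<open>G z *\<^sub>R y + z\<close> is close to \<open>y + z\<close>.\<close>
    have n: "norm (rank_one G y + id_blinfun) = 1 + norm y"
      using D G(1) by (simp add: Daugavet_property_def norm_rank_one)
    have "\<exists>z. (1 + norm y - d) * norm z < norm ((rank_one G y + id_blinfun) z)"
    proof (rule ccontr)
      assume "\<not> ?thesis"
      then have "norm (rank_one G y + id_blinfun) \<le> 1 + norm y - d"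
        by (intro norm_blinfun_bound) (use d norm_ge_zero[of y] in \<open>auto simp: not_less simp del: norm_ge_zero\<close>)
      then show False using n d(1) by simp
    qed
    then obtain z0 where z0: "(1 + norm y - d) * norm z0 < norm (G z0 *\<^sub>R y + z0)"
      by (auto simp: blinfun.add_left)
    then have "z0 \<noteq> 0" by auto
    define s where "s = (if G z0 \<ge> 0 then 1 else (-1::real)) / norm z0"
    define z where "z = s *\<^sub>R z0"
    have nz: "norm z = 1" and Gz: "G z \<ge> 0"
      using \<open>z0 \<noteq> 0\<close> by (auto simp: z_def s_def blinfun.scaleR_right zero_le_divide_iff)
    have "norm (G z *\<^sub>R y + z) = \<bar>s\<bar> * norm (G z0 *\<^sub>R y + z0)"
      by (simp add: z_def blinfun.scaleR_right flip: norm_scaleR scaleR_add_right scaleR_scaleR)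
    also have "\<bar>s\<bar> = 1 / norm z0" by (simp add: s_def)
    finally have big: "1 + norm y - d < norm (G z *\<^sub>R y + z)"
      using z0 \<open>z0 \<noteq> 0\<close> by (simp add: pos_less_divide_eq)
    have G1: "G z \<le> 1" using norm_blinfun[of G z] G(1) nz by simp
    have "norm (G z *\<^sub>R y + z) \<le> G z * norm y + 1"
      using norm_triangle_ineq[of "G z *\<^sub>R y" z] nz Gz by simp
    with big have "norm y - d \<le> G z * norm y" by simp
    then have *: "(1 - G z) * norm y \<le> d" by (simp add: algebra_simps)
    then have "(norm g * (1 - G z)) * norm y \<le> e * norm y"
      using mult_left_mono[OF *, of "norm g"] d(3) by (simp add: mult_ac)
    then have "norm g * (1 - G z) \<le> e" using y by simp
    then have "norm g - e \<le> g z" by (simp add: G(2) algebra_simps)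
    moreover have "norm (G z *\<^sub>R y + z) \<le> norm (y + z) + (1 - G z) * norm y"
    proof -
      have "G z *\<^sub>R y + z = (y + z) - (1 - G z) *\<^sub>R y"
        by (simp add: scaleR_diff_left)
      then have "norm (G z *\<^sub>R y + z) = norm ((y + z) - (1 - G z) *\<^sub>R y)"
        by (rule arg_cong)
      also have "\<dots> \<le> norm (y + z) + norm ((1 - G z) *\<^sub>R y)"
        by (rule norm_triangle_ineq4)
      also have "norm ((1 - G z) *\<^sub>R y) = (1 - G z) * norm y"
        using G1 by simp
      finally show ?thesis .
    qed
    then have "norm y + 1 - e \<le> norm (y + z)" using big * d(2) by linarith
    ultimately show ?thesis by (intro exI[of _ z]) (simp add: nz)
  qed
  obtain h :: "'a dual" where h: "h x0 = norm x0" by (rule norming_functional)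
  \<comment> \<open>If \<open>g = 0\<close> or \<open>y = 0\<close>, the claim for any nonzero replacement is stronger.\<close>
  define g' where "g' = (if g = 0 then h else g)"
  define y' where "y' = (if y = 0 then x0 else y)"
  have "g' \<noteq> 0" "y' \<noteq> 0" using h x0 by (auto simp: g'_def y'_def)
  then obtain x where x: "norm x \<le> 1" "norm g' - e \<le> g' x" "norm y' + 1 - e \<le> norm (y' + x)"
    using main by blast
  show thesis
  proof (rule that[OF x(1)])
    show "norm g - e \<le> g x" using x(2) e by (auto simp: g'_def split: if_splits)
    show "norm y + 1 - e \<le> norm (y + x)"
      using x(3) norm_triangle_ineq[of x0 x] by (auto simp: y'_def split: if_splits)
  qed
qed

section \<open>Greedy averages and the Goldstine theorem\<close>

lemma abs_functional_le_norm:
  fixes f :: "'a::real_normed_vector \<Rightarrow>\<^sub>L real"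
  assumes "norm f \<le> 1"
  shows "\<bar>f x\<bar> \<le> norm x"
  using norm_blinfun[of f x] mult_right_mono[OF assms, of "norm x"] by simp

lemma norm_diff_le_index:
  fixes s :: "nat \<Rightarrow> 'a::real_normed_vector"
  assumes "\<And>k. norm (s (Suc k) - s k) \<le> 1" "m \<le> n"
  shows "norm (s n - s m) \<le> real n - real m"
  using assms(2)
proof (induction n rule: dec_induct)
  case (step n)
  have "norm (s (Suc n) - s m) \<le> norm (s (Suc n) - s n) + norm (s n - s m)"
    using norm_triangle_ineq[of "s (Suc n) - s n" "s n - s m"] by simp
  then show ?case using step assms(1)[of n] by simp
qed simp

text \<open>
  Every \<open>\<phi>\<close> in the unit ball of the bidual is approximated, on countably many functionals, by
  averages of vectors from the unit ball of the space. The vectors are chosen one at a time, each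
  in a slice that pulls the current sum \<open>s k\<close> back towards \<open>k *\<^sub>R \<phi>\<close>; the squared deviation then
  grows only linearly, so that the deviation of the average is of order \<open>1 / sqrt n\<close>. Since each
  step only asks for some vector of one slice, a further condition \<open>Q\<close> on the step can be imposed
  as long as every slice contains vectors satisfying it. For the Daugavet property this replaces
  the usual appeal to convex combinations of slices inside weakly open sets.
\<close>

lemma greedy_sums:
  fixes \<phi> :: "'a::real_normed_vector bidual" and f :: "nat \<Rightarrow> 'a dual"
  assumes \<phi>: "norm \<phi> \<le> 1" and f: "\<And>j. norm (f j) \<le> 1"
    and step: "\<And>g k s. \<exists>x. norm x \<le> 1 \<and> norm g - 1 \<le> blinfun_apply g x \<and> Q k s x"
  obtains s :: "nat \<Rightarrow> 'a" where "s 0 = 0" "\<And>k. norm (s (Suc k) - s k) \<le> 1"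
    "\<And>k. Q k (s k) (s (Suc k) - s k)"
    "\<And>j. (\<lambda>n. blinfun_apply (f j) ((1 / real n) *\<^sub>R s n)) \<longlonglongrightarrow> \<phi> (f j)"
proof -
  have fb: "\<bar>f j x\<bar> \<le> norm x" for j x
    using norm_blinfun[of "f j" x] mult_right_mono[OF f, of "norm x"] by (simp add: order_trans)
  have pb: "\<bar>\<phi> g\<bar> \<le> norm g" for g
    using norm_blinfun[of \<phi> g] mult_right_mono[OF \<phi>, of "norm g"] by (simp add: order_trans)
  have pfb: "\<bar>\<phi> (f j)\<bar> \<le> 1" for j
    using pb[of "f j"] f[of j] by simp
  define w :: "nat \<Rightarrow> real" where "w j = (1 / 2) ^ j" for j
  have w: "summable w" "suminf w = 2" "\<And>j. w j > 0"
    unfolding w_def using geometric_sums[of "1 / 2 :: real"] by (auto simp: sums_iff)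
  have summ: "summable (\<lambda>j. w j *\<^sub>R u j)" if "\<And>j. norm (u j) \<le> C" for C and u :: "nat \<Rightarrow> 'b::banach"
    by (rule summable_comparison_test'[where g = "\<lambda>j. C * w j" and N = 0])
      (use w that in \<open>auto intro: summable_mult simp: mult.commute mult_left_mono less_imp_le\<close>)
  \<comment> \<open>\<open>d k s j\<close> is the deviation of the sum \<open>s\<close> of \<open>k\<close> vectors from \<open>k\<close> times \<open>\<phi>\<close> in the coordinate \<open>f j\<close>.\<close>
  define d where "d k s j = f j s - real k * \<phi> (f j)" for k s j
  have db: "\<bar>d k s j\<bar> \<le> norm s + k" for k s j
  proof -
    have "\<bar>real k * \<phi> (f j)\<bar> \<le> real k * 1"
      unfolding abs_mult by (intro mult_mono) (use pfb in auto)
    then show ?thesis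
      using fb[of j s] by (simp add: d_def)
  qed
  \<comment> \<open>The functional \<open>g k s\<close> is, up to a factor, the negative gradient of the squared weighted
    deviation \<open>\<Sum>j. w j * (d k s j)\<^sup>2\<close>.\<close>
  define g where "g k s = - (\<Sum>j. w j *\<^sub>R (d k s j *\<^sub>R f j))" for k s
  have gsum: "summable (\<lambda>j. w j *\<^sub>R (d k s j *\<^sub>R f j))" for k s
  proof (rule summ)
    show "norm (d k s j *\<^sub>R f j) \<le> (norm s + k) * 1" for j
      unfolding norm_scaleR by (intro mult_mono) (use db f in auto)
  qed
  obtain X where X: "\<And>k s. norm (X k s) \<le> 1" "\<And>k s. norm (g k s) - 1 \<le> g k s (X k s)"
    "\<And>k s. Q k s (X k s)"
  proof -
    have "\<forall>k s. \<exists>x. norm x \<le> 1 \<and> norm (g k s) - 1 \<le> g k s x \<and> Q k s x"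
      using step by blast
    then show thesis
      using that by metis
  qed
  define s where "s = rec_nat 0 (\<lambda>k s. s + X k s)"
  have s0: "s 0 = 0" and sS: "\<And>k. s (Suc k) = s k + X k (s k)"
    by (simp_all add: s_def)
  define E where "E k = (\<Sum>j. w j * (d k (s k) j)\<^sup>2)" for k
  have sq: "a\<^sup>2 \<le> C\<^sup>2" if "\<bar>a\<bar> \<le> C" for a C :: real
    using that by (metis abs_ge_zero abs_le_square_iff abs_of_nonneg order_trans)
  have Esum: "summable (\<lambda>j. w j * (d k (s k) j)\<^sup>2)" for k
    using summ[of "\<lambda>j. (d k (s k) j)\<^sup>2" "(norm (s k) + k)\<^sup>2"] sq[OF db] by simp
  \<comment> \<open>Expanding the square, the mixed term is \<open>2 * (\<phi> g - g x)\<close> and hence at most \<open>2\<close>, because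
    \<open>g x\<close> is within \<open>1\<close> of \<open>norm g\<close>; the new squares contribute at most \<open>4\<close> times the total weight \<open>2\<close>.\<close>
  have E_step: "E (Suc k) \<le> E k + 10" for k
  proof -
    let ?x = "X k (s k)" and ?d = "d k (s k)" and ?g = "g k (s k)"
    let ?r = "\<lambda>j. f j ?x - \<phi> (f j)"
    have dS: "d (Suc k) (s (Suc k)) j = ?d j + ?r j" for j
      by (simp add: d_def sS blinfun.add_right algebra_simps)
    have rb: "\<bar>?r j\<bar> \<le> 2" for j
      using fb[of j ?x] X(1)[of k "s k"] pfb[of j] by linarith
    have "(\<lambda>j. blinfun_apply (w j *\<^sub>R (?d j *\<^sub>R f j)) ?x) sums (- ?g ?x)"
      unfolding g_def using bounded_linear.sums[OF blinfun.bounded_linear_left summable_sums[OF gsum]]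
      by (simp add: blinfun.minus_left)
    moreover have "(\<lambda>j. \<phi> (w j *\<^sub>R (?d j *\<^sub>R f j))) sums (- \<phi> ?g)"
      unfolding g_def using bounded_linear.sums[OF blinfun.bounded_linear_right summable_sums[OF gsum]]
      by (simp add: blinfun.minus_right)
    ultimately have cross: "(\<lambda>j. w j * (?d j * ?r j)) sums (- ?g ?x + \<phi> ?g)"
      using sums_diff by (fastforce simp: blinfun.scaleR_left blinfun.scaleR_right algebra_simps)
    have "summable (\<lambda>j. w j * (?r j)\<^sup>2)"
      using summ[of "\<lambda>j. (?r j)\<^sup>2" "2\<^sup>2"] sq[OF rb] by simp
    then have r2: "(\<lambda>j. w j * (?r j)\<^sup>2) sums (\<Sum>j. w j * (?r j)\<^sup>2)"
      by (rule summable_sums)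
    have "(\<Sum>j. w j * (?r j)\<^sup>2) \<le> (\<Sum>j. w j * 2\<^sup>2)"
      by (intro suminf_le summable_mult2 w(1) sums_summable[OF r2] mult_left_mono sq rb less_imp_le[OF w(3)])
    also have "\<dots> = 8"
      using suminf_mult2[OF w(1), of 4] w(2) by simp
    finally have r8: "(\<Sum>j. w j * (?r j)\<^sup>2) \<le> 8" .
    have "(\<lambda>j. w j * (?d j)\<^sup>2 + 2 * (w j * (?d j * ?r j)) + w j * (?r j)\<^sup>2) sums
        (E k + 2 * (- ?g ?x + \<phi> ?g) + (\<Sum>j. w j * (?r j)\<^sup>2))"
      unfolding E_def by (intro sums_add sums_mult cross r2 summable_sums[OF Esum])
    then have "E (Suc k) = E k + 2 * (- ?g ?x + \<phi> ?g) + (\<Sum>j. w j * (?r j)\<^sup>2)"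
      unfolding E_def dS by (simp add: sums_iff power2_eq_square algebra_simps)
    moreover have "\<phi> ?g \<le> ?g ?x + 1"
      using X(2)[of k "s k"] pb[of ?g] by linarith
    moreover have "e' \<le> e + 10" if "e' = e + 2 * (- a + b) + c" "b \<le> a + 1" "c \<le> 8"
      for a b c e e' :: real
      using that by argo
    ultimately show ?thesis using r8 by blast
  qed
  have E_le: "E n \<le> 10 * n" for n
  proof (induction n)
    case 0
    show ?case by (simp add: E_def d_def s0)
  next
    case (Suc n)
    then show ?case using E_step[of n] by simp
  qed
  have conv: "(\<lambda>n. blinfun_apply (f j) ((1 / real n) *\<^sub>R s n)) \<longlonglongrightarrow> \<phi> (f j)" for j
  proof -
    have bound: "\<bar>f j ((1 / real n) *\<^sub>R s n) - \<phi> (f j)\<bar> \<le> sqrt (10 / w j) * (1 / sqrt n)" if "n > 0" for n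
    proof -
      have "w j * (d n (s n) j)\<^sup>2 \<le> E n"
        unfolding E_def using sum_le_suminf[OF Esum, of "{j}"] w(3) by (simp add: less_imp_le)
      then have "w j * (d n (s n) j)\<^sup>2 \<le> 10 * n"
        using E_le[of n] by simp
      then have "(d n (s n) j)\<^sup>2 \<le> (10 / w j) * n"
        using w(3)[of j] by (simp add: field_simps)
      then have "\<bar>d n (s n) j\<bar> \<le> sqrt ((10 / w j) * n)"
        using real_sqrt_le_mono by fastforce
      then have "\<bar>d n (s n) j\<bar> / n \<le> sqrt ((10 / w j) * n) / n"
        by (simp add: divide_right_mono)
      also have "sqrt ((10 / w j) * n) / n = sqrt (10 / w j) * (1 / sqrt n)"
      proof -
        have "sqrt (real n) / real n = 1 / sqrt n"
          using sqrt_divide_self_eq[of "real n"] by (simp add: inverse_eq_divide)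
        then show ?thesis
          by (metis real_sqrt_mult times_divide_eq_right)
      qed
      also have "\<bar>d n (s n) j\<bar> / n = \<bar>f j ((1 / real n) *\<^sub>R s n) - \<phi> (f j)\<bar>"
      proof -
        have "f j ((1 / real n) *\<^sub>R s n) - \<phi> (f j) = d n (s n) j / n"
          using that by (simp add: d_def blinfun.scaleR_right diff_divide_distrib)
        then show ?thesis by (simp add: abs_divide)
      qed
      finally show ?thesis .
    qed
    have "(\<lambda>n. sqrt (10 / w j) * (1 / sqrt (real n))) \<longlonglongrightarrow> 0"
      by (intro tendsto_mult_right_zero tendsto_divide_0[OF tendsto_const] filterlim_at_top_imp_at_infinity
          filterlim_compose[OF sqrt_at_top] filterlim_real_sequentially)
    then have "(\<lambda>n. blinfun_apply (f j) ((1 / real n) *\<^sub>R s n) - \<phi> (f j)) \<longlonglongrightarrow> 0"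
      by (rule Lim_null_comparison[rotated])
        (use bound in \<open>auto simp: eventually_sequentially intro!: exI[of _ 1]\<close>)
    then show ?thesis
      by (simp add: LIM_zero_iff)
  qed
  show thesis
    by (rule that[of s, OF s0]) (use X conv in \<open>auto simp: sS\<close>)
qed

text \<open>
  The unit ball of \<open>X\<close> is weak-star dense in that of \<open>X**\<close>: greedy averages, with no extra
  condition on the steps, realize every basic neighbourhood.
\<close>

lemma Goldstine:
  fixes \<phi> :: "'a::real_normed_vector bidual"
  assumes \<phi>: "norm \<phi> \<le> 1"
  obtains F :: "'a filter" where "F \<noteq> bot" "\<forall>\<^sub>F x in F. norm x \<le> 1"
    "\<And>f. (blinfun_apply f \<longlongrightarrow> \<phi> f) F"
proof -
  have approx: "\<exists>x. norm x \<le> 1 \<and> (\<forall>f\<in>S. \<bar>blinfun_apply f x - \<phi> f\<bar> < e)"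
    if S: "finite S" and e: "e > 0" for S :: "'a dual set" and e :: real
  proof -
    define f where "f j = sgn (from_nat_into (insert 0 S) j)" for j
    have f_exhaust: "\<exists>j. f j = sgn h" if "h \<in> S" for h
      using from_nat_into_surj[of "insert 0 S" h] S that
      unfolding f_def by (metis countable_finite finite_insert insertCI)
    have step: "\<exists>x. norm x \<le> 1 \<and> norm g - 1 \<le> blinfun_apply g x \<and> True"
      for g :: "'a dual"
    proof (cases "1 \<le> norm g")
      case True
      then obtain x where "norm x = 1" "norm g - 1 < g x"
        using functional_norming_vector[of "norm g - 1" g] by auto
      then show ?thesis by (intro exI[of _ x]) auto
    next
      case False
      then show ?thesis by (intro exI[of _ 0]) auto
    qed
    obtain s where s0: "s 0 = 0" and sS: "\<And>k. norm (s (Suc k) - s k) \<le> 1"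
      and lim: "\<And>j. (\<lambda>n. f j ((1 / real n) *\<^sub>R s n)) \<longlonglongrightarrow> \<phi> (f j)"
    proof (rule greedy_sums[of \<phi> f "\<lambda>_ _ _. True", OF \<phi>])
      show "norm (f j) \<le> 1" for j by (simp add: f_def norm_sgn)
    qed (use step in blast, (rule that; assumption))
    have "\<forall>\<^sub>F n in sequentially. \<bar>blinfun_apply h ((1 / real n) *\<^sub>R s n) - \<phi> h\<bar> < e" if h: "h \<in> S" for h
    proof -
      obtain j where j: "f j = sgn h" using f_exhaust[OF h] by blast
      have "h = norm h *\<^sub>R f j" by (cases "h = 0") (simp_all add: j sgn_div_norm)
      then have hj: "h v = norm h * f j v" "\<phi> h = norm h * \<phi> (f j)" for v
        by (metis blinfun.scaleR_left real_scaleR_def) (metis \<open>h = norm h *\<^sub>R f j\<close> blinfun.scaleR_right real_scaleR_def)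
      have "(\<lambda>n. blinfun_apply h ((1 / real n) *\<^sub>R s n)) \<longlonglongrightarrow> \<phi> h"
        unfolding hj by (rule tendsto_mult_left[OF lim])
      from tendstoD[OF this e] show ?thesis by (simp add: dist_real_def)
    qed
    then have "\<forall>\<^sub>F n in sequentially. \<forall>h\<in>S. \<bar>blinfun_apply h ((1 / real n) *\<^sub>R s n) - \<phi> h\<bar> < e"
      by (intro eventually_ball_finite S) blast
    then obtain n where n: "\<forall>h\<in>S. \<bar>blinfun_apply h ((1 / real n) *\<^sub>R s n) - \<phi> h\<bar> < e"
      using eventually_happens'[OF sequentially_bot] by blast
    have "norm ((1 / real n) *\<^sub>R s n) \<le> 1"
      using norm_diff_le_index[of s 0 n, OF sS] by (cases n) (auto simp: s0 field_simps)
    with n show ?thesis by blast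
  qed
  \<comment> \<open>The filter of the traces on the unit ball of the basic weak-star neighbourhoods of \<open>\<phi>\<close>.\<close>
  define V where "V = (\<lambda>(S, e). {x. norm x \<le> 1 \<and> (\<forall>f\<in>S. \<bar>blinfun_apply f x - \<phi> f\<bar> < e)})"
  define I :: "('a dual set \<times> real) set" where "I = Collect finite \<times> {0<..}"
  define F where "F = (INF i\<in>I. principal (V i))"
  have "F \<noteq> bot"
  proof -
    have "\<exists>k\<in>I. principal (V k) \<le> inf (principal (V i)) (principal (V j))" if "i \<in> I" "j \<in> I" for i j
      using that by (intro bexI[of _ "(fst i \<union> fst j, min (snd i) (snd j))"]) (auto simp: I_def V_def)
    then have "F = bot \<longleftrightarrow> (\<exists>i\<in>I. principal (V i) = bot)"
      unfolding F_def by (intro INF_filter_bot_base)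
    then show ?thesis
      using approx by (fastforce simp: principal_eq_bot_iff V_def I_def)
  qed
  moreover have "\<forall>\<^sub>F x in F. x \<in> V ({f}, e)" if "e > 0" for f e
    unfolding F_def by (rule eventually_INF1[of "({f}, e)"]) (use that in \<open>auto simp: I_def eventually_principal\<close>)
  then have *: "\<forall>\<^sub>F x in F. norm x \<le> 1 \<and> \<bar>blinfun_apply f x - \<phi> f\<bar> < e" if "e > 0" for f e
    using that by (auto simp: V_def)
  have "\<forall>\<^sub>F x in F. norm x \<le> 1"
    using *[of 1 0] by (auto elim: eventually_mono)
  moreover have "(blinfun_apply f \<longlongrightarrow> \<phi> f) F" for f
  proof (rule tendstoI)
    fix e :: real assume "e > 0"
    from *[OF this, of f] show "\<forall>\<^sub>F x in F. dist (f x) (\<phi> f) < e"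
      by eventually_elim (simp add: dist_real_def)
  qed
  ultimately show thesis
    by (rule that)
qed

section \<open>Almost orthogonal elements of the bidual\<close>

text \<open>
  A cluster point \<open>\<psi>\<close> of greedy averages keeps the values of \<open>\<phi>\<close> on all \<open>f j\<close>. The steps \<open>x\<^sub>k\<close> are
  chosen by the Daugavet property such that \<open>norm (x + x\<^sub>1 + \<dots> + x\<^sub>n) \<ge> norm x + n - d\<close> for all \<open>n\<close>.
  A functional norming such a sum is at least \<open>norm x - d\<close> at \<open>x\<close> and at least \<open>m - d\<close> at
  \<open>x\<^sub>1 + \<dots> + x\<^sub>m\<close> for \<open>m \<le> n\<close>; a cluster point \<open>h\<close> of these functionals inherits this for all \<open>m\<close> at
  once, and so it is at least \<open>1 - d\<close> on all averages and hence at \<open>\<psi>\<close>.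
\<close>

lemma Daugavet_extension:
  fixes \<phi> :: "'a::banach bidual" and f :: "nat \<Rightarrow> 'a dual" and x x0 :: 'a
  assumes D: "Daugavet_property TYPE('a)" and x0: "x0 \<noteq> 0"
    and \<phi>: "norm \<phi> \<le> 1" and f: "\<And>j. norm (f j) \<le> 1" and e: "e > 0"
  obtains \<psi> :: "'a bidual" and h :: "'a dual" where "norm \<psi> \<le> 1" "\<And>j. \<psi> (f j) = \<phi> (f j)"
    "norm h \<le> 1" "norm x + 1 - e \<le> h x + \<psi> h"
proof -
  define d where "d = e / 2"
  have d: "d > 0" "e = d + d" using e by (auto simp: d_def)
  \<comment> \<open>The losses \<open>d / 2 ^ Suc k\<close> add up to less than \<open>d\<close>, uniformly in the number of steps.\<close>
  define Q where "Q k s x' \<longleftrightarrow> norm (x + s) + 1 - d * (1 / 2) ^ Suc k \<le> norm (x + s + x')"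
    for k and s x' :: 'a
  have step: "\<exists>x'. norm x' \<le> 1 \<and> norm g - 1 \<le> blinfun_apply g x' \<and> Q k s x'" for g k s
  proof -
    have "min 1 (d * (1 / 2) ^ Suc k) > 0" using d by simp
    then obtain x' where "norm x' \<le> 1" "norm g - min 1 (d * (1 / 2) ^ Suc k) \<le> g x'"
      "norm (x + s) + 1 - min 1 (d * (1 / 2) ^ Suc k) \<le> norm (x + s + x')"
      by (rule Daugavet_property_slice[OF D x0])
    then show ?thesis
      by (intro exI[of _ x']) (auto simp: Q_def min_def split: if_splits)
  qed
  obtain s where s0: "s 0 = 0" and sS: "\<And>k. norm (s (Suc k) - s k) \<le> 1"
    and sQ: "\<And>k. Q k (s k) (s (Suc k) - s k)"
    and lim: "\<And>j. (\<lambda>n. f j ((1 / real n) *\<^sub>R s n)) \<longlonglongrightarrow> \<phi> (f j)"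
    by (rule greedy_sums[of \<phi> f Q, OF \<phi> f step]) (rule that; assumption)
  have big: "norm x + real n - d * (1 - (1 / 2) ^ n) \<le> norm (x + s n)" for n
  proof (induction n)
    case (Suc n)
    have "norm (x + s n) + 1 - d * (1 / 2) ^ Suc n \<le> norm (x + s (Suc n))"
      using sQ[of n] by (simp add: Q_def)
    then show ?case using Suc by (simp add: algebra_simps)
  qed (simp add: s0)
  have "\<exists>h :: 'a dual. blinfun_apply h (x + s n) = norm (x + s n) \<and> norm h \<le> 1" for n
    using norming_functional[of "x + s n"] by blast
  then obtain H :: "nat \<Rightarrow> 'a dual" where H: "\<And>n. H n (x + s n) = norm (x + s n)" "\<And>n. norm (H n) \<le> 1"
    by metis
  have Hle: "H n v \<le> norm v" for n v
    using abs_functional_le_norm[OF H(2)] abs_ge_self order_trans by blast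
  have Hsum: "norm x + real n - d \<le> H n x + H n (s n)" for n
    using big[of n] H(1)[of n] d(1) by (simp add: blinfun.add_right algebra_simps)
      (smt (verit) mult_nonneg_nonneg zero_le_power divide_nonneg_nonneg)
  \<comment> \<open>No summand of \<open>x + s n\<close> exceeds its norm under \<open>H n\<close>, so each partial sum is almost normed.\<close>
  have Hx: "norm x - d \<le> H n x" for n
    using Hsum[of n] Hle[of n "s n"] norm_diff_le_index[of s 0 n, OF sS] by (simp add: s0)
  have Hs: "real m - d \<le> H n (s m)" if "m \<le> n" for m n
    using Hsum[of n] Hle[of n x] Hle[of n "s n - s m"] norm_diff_le_index[of s, OF sS that]
    by (simp add: blinfun.diff_right)
  obtain F h r where F: "F \<noteq> bot" "F \<le> sequentially" and h: "\<And>v. ((\<lambda>n. H n v) \<longlongrightarrow> blinfun_apply h v) F"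
    and r: "((\<lambda>n. norm (H n)) \<longlongrightarrow> r) F" "norm h \<le> r"
    using bounded_functionals_subfilter[of sequentially H 1] H(2) by (auto simp: always_eventually)
  have hx: "norm x - d \<le> h x"
    by (rule tendsto_lowerbound[OF h _ F(1)]) (simp add: Hx)
  have hs: "real m - d \<le> h (s m)" for m
    by (rule tendsto_lowerbound[OF h _ F(1)])
      (rule filter_leD[OF F(2)], use Hs in \<open>auto simp: eventually_sequentially\<close>)
  have "r \<le> 1"
    by (rule tendsto_upperbound[OF r(1) _ F(1)]) (simp add: H(2))
  then have h1: "norm h \<le> 1" using r(2) by simp
  have avg: "norm ((1 / real n) *\<^sub>R s n) \<le> 1" for n
    using norm_diff_le_index[of s 0 n, OF sS] by (cases n) (auto simp: s0 field_simps)
  obtain F' \<psi> r' where F': "F' \<noteq> bot" "F' \<le> sequentially"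
    and \<psi>: "\<And>g. ((\<lambda>n. canonical_embedding ((1 / real n) *\<^sub>R s n) g) \<longlongrightarrow> blinfun_apply \<psi> g) F'"
    and r': "((\<lambda>n. norm (canonical_embedding ((1 / real n) *\<^sub>R s n))) \<longlongrightarrow> r') F'" "norm \<psi> \<le> r'"
    using bounded_functionals_subfilter[of sequentially "\<lambda>n. canonical_embedding ((1 / real n) *\<^sub>R s n)" 1] avg
    by (auto simp: always_eventually simp del: norm_scaleR)
  have "r' \<le> 1"
    by (rule tendsto_upperbound[OF r'(1) _ F'(1)]) (use avg in \<open>simp del: norm_scaleR\<close>)
  then have "norm \<psi> \<le> 1" using r'(2) by simp
  moreover have "\<psi> (f j) = \<phi> (f j)" for j
    using tendsto_unique[OF F'(1) \<psi>[of "f j"]] tendsto_mono[OF F'(2) lim[of j]] by simp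
  moreover have "1 - d \<le> \<psi> h"
  proof (rule tendsto_lowerbound[OF \<psi> _ F'(1)], rule filter_leD[OF F'(2)])
    have "1 - d \<le> h ((1 / real n) *\<^sub>R s n)" if "n \<ge> 1" for n
    proof -
      have "d \<le> d * n" using that d by simp
      then show ?thesis
        using hs[of n] that by (simp add: blinfun.scaleR_right field_simps)
    qed
    then show "\<forall>\<^sub>F n in sequentially. 1 - d \<le> canonical_embedding ((1 / real n) *\<^sub>R s n) h"
      by (auto simp: eventually_sequentially)
  qed
  ultimately show thesis
    using that[of \<psi> h] h1 hx d(2) by simp
qed

definition interpolable :: "('a::real_normed_vector dual \<times> real) set \<Rightarrow> bool"
  where "interpolable R \<longleftrightarrow> (\<exists>\<phi> :: 'a bidual. norm \<phi> \<le> 1 \<and> (\<forall>(f, t)\<in>R. blinfun_apply \<phi> f = t))"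

text \<open>
  Weak-star compactness of the unit ball of the bidual: interpolability is of finite character.
\<close>

lemma interpolable_chain_Union:
  assumes ne: "C \<noteq> {}" and int: "\<And>R. R \<in> C \<Longrightarrow> interpolable R"
    and chain: "\<And>R S. R \<in> C \<Longrightarrow> S \<in> C \<Longrightarrow> R \<subseteq> S \<or> S \<subseteq> R"
  shows "interpolable (\<Union>C :: ('a::real_normed_vector dual \<times> real) set)"
proof -
  define F where "F = (INF R\<in>C. principal {S\<in>C. R \<subseteq> S})"
  have "\<exists>k\<in>C. principal {S\<in>C. k \<subseteq> S} \<le> inf (principal {S\<in>C. i \<subseteq> S}) (principal {S\<in>C. j \<subseteq> S})"
    if "i \<in> C" "j \<in> C" for i j
    using chain[OF that] that by (auto intro: bexI[of _ i] bexI[of _ j])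
  then have "F = bot \<longleftrightarrow> (\<exists>R\<in>C. principal {S\<in>C. R \<subseteq> S} = bot)"
    unfolding F_def by (intro INF_filter_bot_base)
  then have F: "F \<noteq> bot" by (auto simp: principal_eq_bot_iff)
  have ev: "\<forall>\<^sub>F S in F. S \<in> C \<and> R \<subseteq> S" if "R \<in> C" for R
    unfolding F_def by (rule eventually_INF1[OF that]) (simp add: eventually_principal)
  obtain \<Phi> :: "('a dual \<times> real) set \<Rightarrow> 'a bidual"
    where \<Phi>: "\<And>R. R \<in> C \<Longrightarrow> norm (\<Phi> R) \<le> 1" "\<And>R f t. R \<in> C \<Longrightarrow> (f, t) \<in> R \<Longrightarrow> \<Phi> R f = t"
  proof -
    have "\<forall>R\<in>C. \<exists>\<phi> :: 'a bidual. norm \<phi> \<le> 1 \<and> (\<forall>(f, t)\<in>R. blinfun_apply \<phi> f = t)"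
      using int by (simp add: interpolable_def)
    from bchoice[OF this] show thesis
      using that by fast
  qed
  obtain R0 where "R0 \<in> C" using ne by blast
  have "\<forall>\<^sub>F S in F. norm (\<Phi> S) \<le> 1"
    using ev[OF \<open>R0 \<in> C\<close>] by eventually_elim (use \<Phi> in blast)
  from bounded_functionals_subfilter[OF F this] obtain F' \<phi> r where F': "F' \<noteq> bot" "F' \<le> F"
    and lim: "\<And>f. ((\<lambda>S. \<Phi> S f) \<longlongrightarrow> blinfun_apply \<phi> f) F'"
    and r: "((\<lambda>S. norm (\<Phi> S)) \<longlongrightarrow> r) F'" "norm \<phi> \<le> r" by blast
  have "r \<le> 1"
    by (rule tendsto_upperbound[OF r(1) filter_leD[OF F'(2)] F'(1)]) fact
  moreover have "\<phi> f = t" if "R \<in> C" "(f, t) \<in> R" for R f t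
  proof -
    have "\<forall>\<^sub>F S in F. \<Phi> S f = t"
      using ev[OF that(1)] by eventually_elim (use \<Phi>(2) that(2) in blast)
    then have "((\<lambda>S. \<Phi> S f) \<longlongrightarrow> t) F'"
      by (intro tendsto_eventually filter_leD[OF F'(2)])
    then show ?thesis using tendsto_unique[OF F'(1) lim] by blast
  qed
  ultimately show ?thesis
    unfolding interpolable_def using r(2) by (intro exI[of _ \<phi>]) auto
qed

lemma countable_iff_less_aleph1:
  "countable A \<longleftrightarrow> (card_of A, cardSuc natLeq) \<in> ordLess"
  unfolding countable_card_le_natLeq
  using cardSuc_ordLeq_ordLess[OF natLeq_Card_order card_of_Card_order, of A] by blast

text \<open>
  Transfinite recursion of length \<open>\<omega>\<^sub>1\<close>. If a property \<open>P\<close> of sets is preserved by unions of chains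
  and a countable set with \<open>P\<close> can always be enlarged, keeping it countable, so as to satisfy one
  more requirement \<open>Q x\<close>, then \<open>\<aleph>\<^sub>1\<close> many requirements can be met simultaneously, because in a
  well-order of type \<open>\<omega>\<^sub>1\<close> every proper initial segment is countable.
\<close>

lemma aleph1_construction:
  fixes P :: "'r set \<Rightarrow> bool" and Q :: "'d \<Rightarrow> 'r set \<Rightarrow> bool" and D :: "'d set"
  assumes card: "(card_of D, cardSuc natLeq) \<in> ordIso"
    and chain: "\<And>C. C \<noteq> {} \<Longrightarrow> (\<And>R. R \<in> C \<Longrightarrow> P R) \<Longrightarrow>
      (\<And>R S. R \<in> C \<Longrightarrow> S \<in> C \<Longrightarrow> R \<subseteq> S \<or> S \<subseteq> R) \<Longrightarrow> P (\<Union>C)"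
    and ext: "\<And>x R. x \<in> D \<Longrightarrow> countable R \<Longrightarrow> P R \<Longrightarrow> \<exists>S. R \<subseteq> S \<and> countable S \<and> P S \<and> Q x S"
    and R0: "countable R0" "P R0"
  obtains T where "R0 \<subseteq> T" "P T" "\<And>x. x \<in> D \<Longrightarrow> \<exists>S\<subseteq>T. Q x S"
proof -
  define r where "r = card_of D"
  have wo: "well_order_on D r" unfolding r_def by (rule card_of_well_order_on)
  then have wf: "wf (r - Id)" and lin: "linear_order_on D r" by (auto simp: well_order_on_def)
  have fld: "Field r = D" by (simp add: r_def Field_card_of)
  have cnt: "countable (underS r a)" if "a \<in> D" for a
  proof -
    have "(card_of (underS r a), r) \<in> ordLess"
      using card_of_underS[of r a] card_of_Card_order[of D] that fld unfolding r_def by blast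
    then have "(card_of (underS r a), cardSuc natLeq) \<in> ordLess"
      using card unfolding r_def by (rule ordLess_ordIso_trans)
    then show ?thesis by (simp add: countable_iff_less_aleph1)
  qed
  define E where "E R x = (SOME S. R \<subseteq> S \<and> countable S \<and> P S \<and> Q x S)" for R x
  have E: "R \<subseteq> E R x \<and> countable (E R x) \<and> P (E R x) \<and> Q x (E R x)"
    if "x \<in> D" "countable R" "P R" for R x
    unfolding E_def by (rule someI_ex) (rule ext[OF that])
  define F where "F = wfrec (r - Id) (\<lambda>F a. E (R0 \<union> \<Union>(F ` underS r a)) a)"
  have F: "F a = E (R0 \<union> \<Union>(F ` underS r a)) a" for a
  proof -
    have "cut F (r - Id) a ` underS r a = F ` underS r a"
      by (rule image_cong) (auto simp: underS_def cut_apply)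
    then show ?thesis
      unfolding F_def by (subst wfrec[OF wf]) (simp add: F_def)
  qed
  define G where "G a \<longleftrightarrow> countable (F a) \<and> P (F a) \<and> Q a (F a) \<and> R0 \<subseteq> F a \<and> (\<forall>b\<in>underS r a. F b \<subseteq> F a)"
    for a
  have P_Union: "P (R0 \<union> \<Union>(F ` B))" if "B \<subseteq> D" "\<And>b. b \<in> B \<Longrightarrow> G b" for B
  proof -
    have lin': "b = c \<or> b \<in> underS r c \<or> c \<in> underS r b" if "b \<in> D" "c \<in> D" for b c
      using lin that unfolding linear_order_on_def total_on_def underS_def by blast
    have "P (\<Union>(insert R0 (F ` B)))"
    proof (rule chain)
      show "P R" if "R \<in> insert R0 (F ` B)" for R
        using that \<open>\<And>b. b \<in> B \<Longrightarrow> G b\<close> R0 by (auto simp: G_def)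
      show "R \<subseteq> S \<or> S \<subseteq> R" if "R \<in> insert R0 (F ` B)" "S \<in> insert R0 (F ` B)" for R S
      proof -
        have "F b \<subseteq> F c \<or> F c \<subseteq> F b" if "b \<in> B" "c \<in> B" for b c
          using lin'[of b c] that \<open>B \<subseteq> D\<close> \<open>\<And>b. b \<in> B \<Longrightarrow> G b\<close> unfolding G_def by blast
        moreover have "R0 \<subseteq> F b" if "b \<in> B" for b
          using \<open>\<And>b. b \<in> B \<Longrightarrow> G b\<close>[OF that] by (simp add: G_def)
        ultimately show ?thesis
          using that by blast
      qed
    qed simp
    then show ?thesis by simp
  qed
  have G: "a \<in> D \<longrightarrow> G a" for a
  proof (induction a rule: wf_induct_rule[OF wf])
    case (1 a)
    show ?case
    proof
      assume a: "a \<in> D"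
      have "underS r a \<subseteq> D"
        using fld by (auto simp: underS_def Field_def)
      moreover have IH: "G b" if "b \<in> underS r a" for b
        using 1[of b] that \<open>underS r a \<subseteq> D\<close> by (auto simp: underS_def)
      ultimately have "P (R0 \<union> \<Union>(F ` underS r a))"
        by (intro P_Union)
      moreover have "countable (R0 \<union> \<Union>(F ` underS r a))"
        using R0 cnt[OF a] IH by (auto simp: G_def)
      ultimately show "G a"
        using E[OF a] F[of a] unfolding G_def by (metis (no_types, lifting) Sup_upper Un_subset_iff image_eqI subset_trans)
    qed
  qed
  show thesis
    by (rule that[of "R0 \<union> \<Union>(F ` D)"]) (use P_Union[of D] G in \<open>auto simp: G_def\<close>)
qed

lemma nontrivial_if_density_omega_1:
  assumes "has_density_character TYPE('a::banach) omega_1"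
  obtains x :: "'a::banach" where "x \<noteq> 0"
proof -
  obtain A :: "'a set" where A: "(card_of A, cardSuc natLeq) \<in> ordIso"
    using assms by (auto simp: has_density_character_def omega_1_def)
  then have "\<not> countable A"
    using not_ordLess_ordIso by (auto simp: countable_iff_less_aleph1)
  then have "\<not> A \<subseteq> {0}"
    by (auto dest: countable_subset)
  then show thesis using that by blast
qed

text \<open>
  The recursion is run over a dense set of cardinality \<open>\<aleph>\<^sub>1\<close>, the sets being partial prescriptions
  of \<open>u\<close> on functionals of norm at most \<open>1\<close>.
\<close>

lemma almost_L_orthogonal:
  fixes f :: "'a::banach dual"
  assumes D: "Daugavet_property TYPE('a)" and dens: "has_density_character TYPE('a) omega_1"
    and e: "e > 0"
  obtains u :: "'a bidual" where "norm u \<le> 1" "u f = norm f"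
    "\<And>x. norm x + 1 - e \<le> norm (canonical_embedding x + u)"
proof -
  obtain A :: "'a set" where A: "closure A = UNIV" "(card_of A, cardSuc natLeq) \<in> ordIso"
    using dens by (auto simp: has_density_character_def omega_1_def)
  obtain x0 :: 'a where x0: "x0 \<noteq> 0"
    by (rule nontrivial_if_density_omega_1[OF dens])
  define P :: "('a dual \<times> real) set \<Rightarrow> bool"
    where "P R \<longleftrightarrow> interpolable R \<and> R \<subseteq> {(g, t). norm g \<le> 1}" for R
  define Q :: "'a \<Rightarrow> ('a dual \<times> real) set \<Rightarrow> bool"
    where "Q x R \<longleftrightarrow> (\<exists>(g, t)\<in>R. norm x + 1 - e \<le> g x + t)" for x R
  \<comment> \<open>Normalizing \<open>f\<close> keeps all prescribed functionals in the unit ball.\<close>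
  let ?R0 = "{(sgn f, norm (sgn f))}"
  have P0: "P ?R0"
  proof -
    obtain \<phi> :: "'a bidual" where "\<phi> (sgn f) = norm (sgn f)" "norm \<phi> \<le> 1"
      by (rule norming_functional)
    then show ?thesis by (auto simp: P_def interpolable_def norm_sgn)
  qed
  have ext: "\<exists>S. R \<subseteq> S \<and> countable S \<and> P S \<and> Q x S" if R: "countable R" "P R" for x R
  proof -
    obtain \<phi> :: "'a bidual" where \<phi>: "norm \<phi> \<le> 1" "\<And>g t. (g, t) \<in> R \<Longrightarrow> \<phi> g = t"
      using R(2) unfolding P_def interpolable_def by fast
    \<comment> \<open>Adding \<open>0\<close> provides an enumeration even if \<open>R\<close> is empty.\<close>
    define k where "k = from_nat_into (insert 0 (fst ` R))"
    have rng: "range k = insert 0 (fst ` R)"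
      unfolding k_def using R(1) by (intro range_from_nat_into) auto
    then have "norm (k j) \<le> 1" for j
      using R(2) rangeI[of k j] by (auto simp: P_def)
    then obtain \<psi> :: "'a bidual" and h :: "'a dual" where \<psi>: "norm \<psi> \<le> 1" "\<And>j. \<psi> (k j) = \<phi> (k j)"
      and h: "norm h \<le> 1" "norm x + 1 - e \<le> h x + \<psi> h"
      using Daugavet_extension[OF D x0 \<phi>(1) _ e, of k x] by blast
    have "\<psi> g = t" if "(g, t) \<in> R" for g t
    proof -
      have "g \<in> range k" unfolding rng using that by force
      then show ?thesis using \<psi>(2) \<phi>(2)[OF that] by auto
    qed
    then have "interpolable (insert (h, \<psi> h) R)"
      unfolding interpolable_def using \<psi>(1) by (intro exI[of _ \<psi>]) auto
    then show ?thesis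
      using R h by (intro exI[of _ "insert (h, \<psi> h) R"]) (auto simp: P_def Q_def)
  qed
  have chain: "P (\<Union>C)" if "C \<noteq> {}" "\<And>R. R \<in> C \<Longrightarrow> P R"
    "\<And>R S. R \<in> C \<Longrightarrow> S \<in> C \<Longrightarrow> R \<subseteq> S \<or> S \<subseteq> R" for C
    using interpolable_chain_Union[OF that(1) _ that(3)] that(2) by (auto simp: P_def)
  obtain T where T: "?R0 \<subseteq> T" "P T" "\<And>x. x \<in> A \<Longrightarrow> \<exists>S\<subseteq>T. Q x S"
    by (rule aleph1_construction[of A P Q ?R0, OF A(2)])
      (use ext P0 chain in auto)
  obtain u :: "'a bidual" where u: "norm u \<le> 1" "\<And>g t. (g, t) \<in> T \<Longrightarrow> u g = t"
    using T(2) unfolding P_def interpolable_def by fast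
  show thesis
  proof (rule that[OF u(1)])
    have "u (sgn f) = norm (sgn f)" using T(1) u(2) by auto
    then have "norm f * u (sgn f) = norm f * norm (sgn f)" by simp
    then show "u f = norm f"
      by (cases "f = 0") (auto simp: sgn_div_norm blinfun.scaleR_right field_simps)
    fix x
    show "norm x + 1 - e \<le> norm (canonical_embedding x + u)"
    proof (rule field_le_epsilon)
      fix d :: real assume "d > 0"
      then obtain y where y: "y \<in> A" "dist y x < d / 2"
        using A(1) closure_approachable[of x A] by (metis UNIV_I half_gt_zero)
      obtain g t where gt: "(g, t) \<in> T" "norm y + 1 - e \<le> g y + t"
        using T(3)[OF y(1)] by (auto simp: Q_def)
      have "norm g \<le> 1" using gt(1) T(2) by (auto simp: P_def)
      have "norm y + 1 - e \<le> (canonical_embedding y + u) g"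
        using gt u(2) by (simp add: blinfun.add_left)
      also have "\<dots> \<le> norm (canonical_embedding y + u) * norm g"
        using norm_blinfun[of "canonical_embedding y + u" g] by simp
      also have "\<dots> \<le> norm (canonical_embedding y + u)"
        using mult_left_mono[OF \<open>norm g \<le> 1\<close>, of "norm (canonical_embedding y + u)"] by simp
      also have "\<dots> \<le> norm (canonical_embedding x + u) + norm (canonical_embedding (y - x))"
        using norm_triangle_ineq[of "canonical_embedding x + u" "canonical_embedding (y - x)"]
        by (simp add: linear_diff[OF linear_canonical_embedding] add.commute)
      finally have "norm y + 1 - e \<le> norm (canonical_embedding x + u) + norm (y - x)"
        by simp
      moreover have "norm x \<le> norm y + norm (y - x)"
        using norm_triangle_ineq2[of x y] by (simp add: norm_minus_commute)
      ultimately show "norm x + 1 - e \<le> norm (canonical_embedding x + u) + d"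
        using y(2) by (simp add: dist_norm)
    qed
  qed
qed

section \<open>Projections from the bidual and approximation by finite-rank operators\<close>

text \<open>
  The projection onto \<open>X\<close> along \<open>Z\<close>; it is linear because the decomposition is unique.
\<close>

lemma L_embedded_projection:
  assumes "L_embedded TYPE('a::banach)"
  obtains P :: "'a::banach bidual \<Rightarrow> 'a" where "linear P" "\<And>x. P (canonical_embedding x) = x"
    "\<And>\<phi>. norm \<phi> = norm (P \<phi>) + norm (\<phi> - canonical_embedding (P \<phi>))"
proof -
  obtain Z :: "'a bidual set" where Z: "subspace Z" "range canonical_embedding \<inter> Z = {0}"
    and dec: "\<And>\<phi>. \<exists>x. \<exists>z\<in>Z. \<phi> = canonical_embedding x + z"
    and nrm: "\<And>x z. z \<in> Z \<Longrightarrow> norm (canonical_embedding x + z) = norm x + norm z"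
    using assms unfolding L_embedded_def by blast
  note J = linear_canonical_embedding
  have "\<exists>x. \<phi> - canonical_embedding x \<in> Z" for \<phi>
    using dec[of \<phi>] by (metis add_diff_cancel_left')
  then obtain P where P: "\<And>\<phi>. \<phi> - canonical_embedding (P \<phi>) \<in> Z"
    by metis
  have uniq: "P \<phi> = x" if "\<phi> - canonical_embedding x \<in> Z" for \<phi> x
  proof -
    have "canonical_embedding (P \<phi> - x) \<in> Z"
      using subspace_diff[OF Z(1) that P[of \<phi>]] by (simp add: linear_diff[OF J])
    then have "canonical_embedding (P \<phi> - x) = 0"
      using Z(2) by blast
    then have "norm (P \<phi> - x) = 0"
      by (metis norm_canonical_embedding norm_zero)
    then show ?thesis by simp
  qed
  have "linear P"
  proof (rule linearI)
    show "P (\<phi> + \<psi>) = P \<phi> + P \<psi>" for \<phi> \<psi>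
      using subspace_add[OF Z(1) P[of \<phi>] P[of \<psi>]]
      by (intro uniq) (simp add: linear_add[OF J] algebra_simps)
    show "P (c *\<^sub>R \<phi>) = c *\<^sub>R P \<phi>" for c \<phi>
      using subspace_scale[OF Z(1) P[of \<phi>], of c]
      by (intro uniq) (simp add: linear_scale[OF J] algebra_simps)
  qed
  moreover have "P (canonical_embedding x) = x" for x
    by (rule uniq) (simp add: subspace_0[OF Z(1)])
  moreover have "norm \<phi> = norm (P \<phi>) + norm (\<phi> - canonical_embedding (P \<phi>))" for \<phi>
    using nrm[OF P[of \<phi>], of "P \<phi>"] by simp
  ultimately show thesis by (rule that)
qed

text \<open>
  The coordinates of a bounded finite-rank operator can be taken bounded. This holds by induction
  on the number of vectors spanning the range: if \<open>v\<close> is in the range and \<open>h\<close> is a bounded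
  functional with \<open>h v = 1\<close>, then subtracting \<open>(h \<circ> S) \<otimes> v\<close> from \<open>S\<close> lowers that number.
\<close>

lemma finite_rank_decomposition:
  fixes S :: "'a::real_normed_vector \<Rightarrow>\<^sub>L 'b::real_normed_vector"
  assumes "finite_rank S"
  obtains qs :: "('a dual \<times> 'b) list" where "\<And>x. S x = (\<Sum>(s, v)\<leftarrow>qs. blinfun_apply s x *\<^sub>R v)"
proof -
  have claim: "\<exists>qs :: ('a dual \<times> 'b) list. \<forall>x. S x = (\<Sum>(s, v)\<leftarrow>qs. blinfun_apply s x *\<^sub>R v)"
    if "finite B" "card B \<le> n" "range (blinfun_apply S) \<subseteq> span B" for B n and S :: "'a \<Rightarrow>\<^sub>L 'b"
    using that
  proof (induction n arbitrary: B S)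
    case 0
    then have "S x = 0" for x by auto
    then show ?case by (intro exI[of _ "[]"]) simp
  next
    case (Suc n)
    show ?case
    proof (cases "card B \<le> n")
      case True
      then show ?thesis using Suc by blast
    next
      case False
      then obtain b C where B: "B = insert b C" "b \<notin> C"
        by (metis card.empty equals0I mk_disjoint_insert zero_le)
      then have C: "finite C" "card C \<le> n" using Suc.prems by auto
      show ?thesis
      proof (cases "range (blinfun_apply S) \<subseteq> span C")
        case True
        then show ?thesis using Suc.IH[OF C] by blast
      next
        case False
        then obtain v where v: "v \<in> range (blinfun_apply S)" "v \<notin> span C" by blast
        then have "b \<in> span (insert v C)"
          using in_span_insert[of v b C] Suc.prems(3) B by blast
        then have "span (insert b C) \<subseteq> span (insert v C)"
          by (intro span_minimal) (auto intro: span_base)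
        then have rng: "range (blinfun_apply S) \<subseteq> span (insert v C)"
          using Suc.prems(3) B by blast
        have "v \<noteq> 0" using v(2) span_zero by metis
        obtain h0 :: "'b dual" where h0: "h0 v = norm v" by (rule norming_functional)
        define h where "h = (1 / norm v) *\<^sub>R h0"
        have h: "h v = 1" using h0 \<open>v \<noteq> 0\<close> by (simp add: h_def blinfun.scaleR_left)
        \<comment> \<open>The projection \<open>p\<close> kills \<open>v\<close>, so \<open>p \<circ> S\<close> has its range in the span of \<open>n\<close> vectors.\<close>
        define p where "p w = w - h w *\<^sub>R v" for w
        have lin: "linear p"
          by (rule linearI) (simp_all add: p_def blinfun.add_right blinfun.scaleR_right algebra_simps)
        define S' where "S' = S - rank_one (h o\<^sub>L S) v"
        have S': "S' x = p (S x)" for x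
          by (simp add: S'_def p_def blinfun.diff_left)
        have "range (blinfun_apply S') = p ` range (blinfun_apply S)"
          by (auto simp: S')
        also have "\<dots> \<subseteq> p ` span (insert v C)"
          using rng by (rule image_mono)
        also have "\<dots> = span (p ` C)"
          using h by (simp add: linear_span_image[OF lin, symmetric] p_def[of v] span_insert_0)
        finally have "range (blinfun_apply S') \<subseteq> span (p ` C)" .
        then obtain qs :: "('a dual \<times> 'b) list"
          where qs: "\<And>x. S' x = (\<Sum>(s, v)\<leftarrow>qs. blinfun_apply s x *\<^sub>R v)"
          using Suc.IH[of "p ` C" S'] C card_image_le[OF C(1), of p] by auto
        have "S x = (\<Sum>(s, v)\<leftarrow>(h o\<^sub>L S, v) # qs. blinfun_apply s x *\<^sub>R v)" for x
          using qs[of x] by (simp add: S' p_def algebra_simps)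
        then show ?thesis by blast
      qed
    qed
  qed
  obtain B where "finite B" "range (blinfun_apply S) \<subseteq> span B"
    using assms unfolding finite_rank_def by blast
  from claim[OF this(1) order_refl this(2)] show thesis
    using that by blast
qed

text \<open>
  Norms at most \<open>1\<close> instead of equal to \<open>1\<close> make the notion stable under composition with the
  projection from the bidual.
\<close>

definition contractive_approximation :: "('a::real_normed_vector \<Rightarrow>\<^sub>L 'a) filter \<Rightarrow> bool"
  where "contractive_approximation F \<longleftrightarrow> F \<noteq> bot \<and> (\<forall>\<^sub>F S in F. finite_rank S \<and> norm S \<le> 1) \<and>
    (\<forall>x. ((\<lambda>S. blinfun_apply S x) \<longlongrightarrow> x) F)"

lemma contractive_approximation_if_MAP:
  assumes "metric_approximation_property TYPE('a::banach)"
  obtains F :: "('a::banach \<Rightarrow>\<^sub>L 'a) filter" where "contractive_approximation F"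
proof -
  obtain F :: "('a \<Rightarrow>\<^sub>L 'a) filter" where F: "F \<noteq> bot" "\<forall>\<^sub>F S in F. finite_rank S \<and> norm S = 1"
    "\<And>x. ((\<lambda>S. blinfun_apply S x) \<longlongrightarrow> x) F"
    using assms unfolding metric_approximation_property_def by blast
  have "\<forall>\<^sub>F S in F. finite_rank S \<and> norm S \<le> 1"
    using F(2) by eventually_elim simp
  then show thesis
    using that[of F] F unfolding contractive_approximation_def by blast
qed

text \<open>
  Finite-rank contractions \<open>S\<close> on \<open>X**\<close> induce the finite-rank contractions \<open>P \<circ> S\<close> on the
  subspace \<open>X\<close>, which converge pointwise because \<open>P\<close> is continuous and fixes \<open>X\<close>.
\<close>

lemma contractive_approximation_below_bidual:
  fixes P :: "'a::banach bidual \<Rightarrow> 'a"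
  assumes P: "linear P" "\<And>x. P (canonical_embedding x) = x" "\<And>\<phi>. norm (P \<phi>) \<le> norm \<phi>"
    and F: "contractive_approximation (F :: ('a bidual \<Rightarrow>\<^sub>L 'a bidual) filter)"
  obtains G :: "('a \<Rightarrow>\<^sub>L 'a) filter" where "contractive_approximation G"
proof -
  have bP: "bounded_linear P"
    by (rule bounded_linear_intro[where K = 1])
      (simp_all add: linear_add[OF P(1)] linear_scale[OF P(1)] P(3))
  have bJ: "bounded_linear (canonical_embedding :: 'a \<Rightarrow> _)"
    by (rule bounded_linear_intro[where K = 1])
      (simp_all add: linear_add[OF linear_canonical_embedding] linear_scale[OF linear_canonical_embedding])
  define T where "T S = Blinfun (\<lambda>x. P (blinfun_apply S (canonical_embedding x)))"
    for S :: "'a bidual \<Rightarrow>\<^sub>L 'a bidual"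
  have T: "T S x = P (S (canonical_embedding x))" for S x
    unfolding T_def
    by (subst bounded_linear_Blinfun_apply)
      (auto intro!: bounded_linear_compose[OF bP] blinfun.bounded_linear_right bounded_linear_compose[OF _ bJ])
  have "finite_rank (T S) \<and> norm (T S) \<le> 1" if S: "finite_rank S \<and> norm S \<le> 1" for S
  proof
    obtain B where B: "finite B" "range (blinfun_apply S) \<subseteq> span B"
      using S by (auto simp: finite_rank_def)
    have "range (blinfun_apply (T S)) \<subseteq> P ` range (blinfun_apply S)"
      by (auto simp: T)
    also have "\<dots> \<subseteq> P ` span B"
      using B(2) by (rule image_mono)
    also have "\<dots> = span (P ` B)"
      by (simp add: linear_span_image[OF P(1)])
    finally show "finite_rank (T S)"
      using B(1) unfolding finite_rank_def by blast
    have "norm (T S x) \<le> 1 * norm x" for x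
    proof -
      have "norm (T S x) \<le> norm S * norm (canonical_embedding x)"
        unfolding T using P(3) norm_blinfun order_trans by blast
      also have "\<dots> \<le> 1 * norm x"
        using S by (simp add: mult_left_le_one_le)
      finally show ?thesis .
    qed
    then show "norm (T S) \<le> 1"
      by (intro norm_blinfun_bound) auto
  qed
  then have "\<forall>\<^sub>F S in filtermap T F. finite_rank S \<and> norm S \<le> 1"
    using F unfolding contractive_approximation_def eventually_filtermap by (auto elim: eventually_mono)
  moreover have "((\<lambda>S. blinfun_apply S x) \<longlongrightarrow> x) (filtermap T F)" for x
  proof -
    have "((\<lambda>S. blinfun_apply S (canonical_embedding x)) \<longlongrightarrow> canonical_embedding x) F"
      using F by (simp add: contractive_approximation_def)
    from bounded_linear.tendsto[OF bP this] show ?thesis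
      by (simp add: filterlim_filtermap T P(2))
  qed
  ultimately have "contractive_approximation (filtermap T F)"
    using F by (simp add: contractive_approximation_def filtermap_bot_iff)
  then show thesis by (rule that)
qed

section \<open>Norming a tensor by a finite-rank form\<close>

lemma norm_elem_tensor_le: "norm (x \<otimes>\<^sub>t y) \<le> norm x * norm y"
  using proj_norm_le[of "x \<otimes>\<^sub>t y" "[(x, y)]"] by (simp add: norm_tensor_def elem_tensor.abs_eq)

lemma functional_elem_tensor_le:
  fixes \<Psi> :: "('a::real_normed_vector, 'b::real_normed_vector) tensor dual"
  shows "\<bar>\<Psi> (x \<otimes>\<^sub>t y)\<bar> \<le> norm \<Psi> * (norm x * norm y)"
  using norm_blinfun[of \<Psi> "x \<otimes>\<^sub>t y"] mult_left_mono[OF norm_elem_tensor_le[of x y], of "norm \<Psi>"]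
  by simp

lemma functional_abs_tensor:
  fixes \<Psi> :: "('a::real_normed_vector, 'b::real_normed_vector) tensor dual"
  shows "\<Psi> (abs_tensor xs) = eval_sum (\<lambda>x y. \<Psi> (x \<otimes>\<^sub>t y)) xs"
  unfolding abs_tensor_eq by (induction xs) (auto simp: blinfun.add_right)

lemma functional_tensor_left:
  fixes \<Psi> :: "('a::real_normed_vector, 'b::real_normed_vector) tensor dual"
  obtains f :: "'a dual" where "\<And>x. f x = \<Psi> (x \<otimes>\<^sub>t y)"
proof -
  have "bounded_linear (\<lambda>x. \<Psi> (x \<otimes>\<^sub>t y))"
    by (rule bounded_linear_intro[where K = "norm \<Psi> * norm y"])
      (use functional_elem_tensor_le[of \<Psi> _ y] in \<open>simp_all add: bilinear_ladd[OF bilinear_elem_tensor]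
        bilinear_lmul[OF bilinear_elem_tensor] blinfun.add_right blinfun.scaleR_right mult_ac\<close>)
  from bounded_linear_Blinfun_apply[OF this] show thesis
    using that by metis
qed

lemma functional_tensor_right:
  fixes \<Psi> :: "('a::real_normed_vector, 'b::real_normed_vector) tensor dual"
  obtains g :: "'b dual" where "\<And>y. g y = \<Psi> (x \<otimes>\<^sub>t y)"
proof -
  have "bounded_linear (\<lambda>y. \<Psi> (x \<otimes>\<^sub>t y))"
    by (rule bounded_linear_intro[where K = "norm \<Psi> * norm x"])
      (use functional_elem_tensor_le[of \<Psi> x] in \<open>simp_all add: bilinear_radd[OF bilinear_elem_tensor]
        bilinear_rmul[OF bilinear_elem_tensor] blinfun.add_right blinfun.scaleR_right mult_ac\<close>)
  from bounded_linear_Blinfun_apply[OF this] show thesis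
    using that by metis
qed

text \<open>
  The bilinear form on \<open>X \<times> Y\<close> represented by an element of \<open>X* \<otimes> Y*\<close>.
\<close>

definition nuclear_form :: "('a::real_normed_vector dual \<times> 'b::real_normed_vector dual) list \<Rightarrow> 'a \<Rightarrow> 'b \<Rightarrow> real"
  where "nuclear_form ps x y = (\<Sum>(s, g)\<leftarrow>ps. s x * g y)"

lemma nuclear_form_simps [simp]:
  "nuclear_form [] x y = 0"
  "nuclear_form ((s, g) # ps) x y = s x * g y + nuclear_form ps x y"
  by (simp_all add: nuclear_form_def)

text \<open>
  Let \<open>\<Psi>\<close> be a functional norming the tensor. The forms \<open>\<Psi> (S x \<otimes> y)\<close> with \<open>S\<close> from the
  approximating net are of finite rank and converge to \<open>\<Psi>\<close> on the given tensor.
\<close>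

lemma norming_nuclear_form_left:
  fixes xs :: "('a::real_normed_vector \<times> 'b::real_normed_vector) list"
  assumes F: "contractive_approximation (F :: ('a \<Rightarrow>\<^sub>L 'a) filter)" and e: "e > 0"
  obtains ps :: "('a dual \<times> 'b dual) list" where
    "\<And>x y. \<bar>nuclear_form ps x y\<bar> \<le> norm x * norm y"
    "norm (abs_tensor xs) - e < eval_sum (nuclear_form ps) xs"
proof -
  obtain \<Psi> :: "('a, 'b) tensor dual" where \<Psi>: "\<Psi> (abs_tensor xs) = norm (abs_tensor xs)" "norm \<Psi> \<le> 1"
    by (rule norming_functional)
  have "((\<lambda>S. eval_sum (\<lambda>x y. \<Psi> (blinfun_apply S x \<otimes>\<^sub>t y)) xs) \<longlongrightarrow> eval_sum (\<lambda>x y. \<Psi> (x \<otimes>\<^sub>t y)) xs) F"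
  proof (induction xs)
    case (Cons p xs)
    obtain x y where p: "p = (x, y)" by (cases p)
    obtain f :: "'a dual" where f: "\<And>x. f x = \<Psi> (x \<otimes>\<^sub>t y)"
      using functional_tensor_left[of \<Psi> y] by metis
    have "((\<lambda>S. f (blinfun_apply S x)) \<longlongrightarrow> f x) F"
      using F by (intro blinfun.tendsto tendsto_const) (auto simp: contractive_approximation_def)
    then show ?case using Cons.IH by (auto simp: p f intro: tendsto_add)
  qed simp
  then have "\<forall>\<^sub>F S in F. norm (abs_tensor xs) - e < eval_sum (\<lambda>x y. \<Psi> (blinfun_apply S x \<otimes>\<^sub>t y)) xs"
    using e \<Psi>(1) by (intro order_tendstoD(1)) (auto simp: functional_abs_tensor)
  moreover have "\<forall>\<^sub>F S in F. finite_rank S \<and> norm S \<le> 1"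
    using F by (simp add: contractive_approximation_def)
  ultimately have "\<forall>\<^sub>F S in F. norm (abs_tensor xs) - e < eval_sum (\<lambda>x y. \<Psi> (blinfun_apply S x \<otimes>\<^sub>t y)) xs \<and>
      finite_rank S \<and> norm S \<le> 1"
    by (rule eventually_conj)
  then obtain S where S: "norm (abs_tensor xs) - e < eval_sum (\<lambda>x y. \<Psi> (blinfun_apply S x \<otimes>\<^sub>t y)) xs"
      "finite_rank S" "norm S \<le> 1"
    using F eventually_happens' unfolding contractive_approximation_def by blast
  obtain qs where qs: "\<And>x. S x = (\<Sum>(s, v)\<leftarrow>qs. blinfun_apply s x *\<^sub>R v)"
    using finite_rank_decomposition[OF S(2)] by blast
  have "\<exists>g :: 'b dual. \<forall>y. g y = \<Psi> (v \<otimes>\<^sub>t y)" for v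
    using functional_tensor_right[of \<Psi> v] by metis
  then obtain G :: "'a \<Rightarrow> 'b dual" where G: "\<And>v y. G v y = \<Psi> (v \<otimes>\<^sub>t y)"
    by metis
  define ps where "ps = map (\<lambda>(s, v). (s, G v)) qs"
  have ps: "nuclear_form ps x y = \<Psi> (blinfun_apply S x \<otimes>\<^sub>t y)" for x y
    unfolding ps_def qs
    by (induction qs) (auto simp: G bilinear_lzero[OF bilinear_elem_tensor] bilinear_ladd[OF bilinear_elem_tensor]
        bilinear_lmul[OF bilinear_elem_tensor] blinfun.add_right blinfun.scaleR_right)
  show thesis
  proof (rule that[of ps])
    fix x y
    have "\<bar>\<Psi> (blinfun_apply S x \<otimes>\<^sub>t y)\<bar> \<le> norm (blinfun_apply S x \<otimes>\<^sub>t y)"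
      by (rule abs_functional_le_norm[OF \<Psi>(2)])
    also have "\<dots> \<le> norm (S x) * norm y"
      by (rule norm_elem_tensor_le)
    also have "\<dots> \<le> norm x * norm y"
      using norm_blinfun[of S x] mult_right_mono[OF S(3), of "norm x"] by (intro mult_right_mono) auto
    finally show "\<bar>nuclear_form ps x y\<bar> \<le> norm x * norm y" by (simp add: ps)
    show "norm (abs_tensor xs) - e < eval_sum (nuclear_form ps) xs"
      using S(1) unfolding ps[symmetric] .
  qed
qed

text \<open>
  The mirror image, with the forms \<open>\<Psi> (x \<otimes> S y)\<close>.
\<close>

lemma norming_nuclear_form_right:
  fixes xs :: "('a::real_normed_vector \<times> 'b::real_normed_vector) list"
  assumes F: "contractive_approximation (F :: ('b \<Rightarrow>\<^sub>L 'b) filter)" and e: "e > 0"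
  obtains ps :: "('a dual \<times> 'b dual) list" where
    "\<And>x y. \<bar>nuclear_form ps x y\<bar> \<le> norm x * norm y"
    "norm (abs_tensor xs) - e < eval_sum (nuclear_form ps) xs"
proof -
  obtain \<Psi> :: "('a, 'b) tensor dual" where \<Psi>: "\<Psi> (abs_tensor xs) = norm (abs_tensor xs)" "norm \<Psi> \<le> 1"
    by (rule norming_functional)
  have "((\<lambda>S. eval_sum (\<lambda>x y. \<Psi> (x \<otimes>\<^sub>t blinfun_apply S y)) xs) \<longlongrightarrow> eval_sum (\<lambda>x y. \<Psi> (x \<otimes>\<^sub>t y)) xs) F"
  proof (induction xs)
    case (Cons p xs)
    obtain x y where p: "p = (x, y)" by (cases p)
    obtain f :: "'b dual" where f: "\<And>y. f y = \<Psi> (x \<otimes>\<^sub>t y)"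
      using functional_tensor_right[of \<Psi> x] by metis
    have "((\<lambda>S. f (blinfun_apply S y)) \<longlongrightarrow> f y) F"
      using F by (intro blinfun.tendsto tendsto_const) (auto simp: contractive_approximation_def)
    then show ?case using Cons.IH by (auto simp: p f intro: tendsto_add)
  qed simp
  then have "\<forall>\<^sub>F S in F. norm (abs_tensor xs) - e < eval_sum (\<lambda>x y. \<Psi> (x \<otimes>\<^sub>t blinfun_apply S y)) xs"
    using e \<Psi>(1) by (intro order_tendstoD(1)) (auto simp: functional_abs_tensor)
  moreover have "\<forall>\<^sub>F S in F. finite_rank S \<and> norm S \<le> 1"
    using F by (simp add: contractive_approximation_def)
  ultimately have "\<forall>\<^sub>F S in F. norm (abs_tensor xs) - e < eval_sum (\<lambda>x y. \<Psi> (x \<otimes>\<^sub>t blinfun_apply S y)) xs \<and>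
      finite_rank S \<and> norm S \<le> 1"
    by (rule eventually_conj)
  then obtain S where S: "norm (abs_tensor xs) - e < eval_sum (\<lambda>x y. \<Psi> (x \<otimes>\<^sub>t blinfun_apply S y)) xs"
      "finite_rank S" "norm S \<le> 1"
    using F eventually_happens' unfolding contractive_approximation_def by blast
  obtain qs where qs: "\<And>x. S x = (\<Sum>(s, v)\<leftarrow>qs. blinfun_apply s x *\<^sub>R v)"
    using finite_rank_decomposition[OF S(2)] by blast
  have "\<exists>f :: 'a dual. \<forall>x. f x = \<Psi> (x \<otimes>\<^sub>t v)" for v
    using functional_tensor_left[of \<Psi> v] by metis
  then obtain G :: "'b \<Rightarrow> 'a dual" where G: "\<And>v x. G v x = \<Psi> (x \<otimes>\<^sub>t v)"
    by metis
  define ps where "ps = map (\<lambda>(s, v). (G v, s)) qs"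
  have ps: "nuclear_form ps x y = \<Psi> (x \<otimes>\<^sub>t blinfun_apply S y)" for x y
    unfolding ps_def qs
    by (induction qs) (auto simp: G bilinear_rzero[OF bilinear_elem_tensor] bilinear_radd[OF bilinear_elem_tensor]
        bilinear_rmul[OF bilinear_elem_tensor] blinfun.add_right blinfun.scaleR_right)
  show thesis
  proof (rule that[of ps])
    fix x y
    have "\<bar>\<Psi> (x \<otimes>\<^sub>t blinfun_apply S y)\<bar> \<le> norm (x \<otimes>\<^sub>t blinfun_apply S y)"
      by (rule abs_functional_le_norm[OF \<Psi>(2)])
    also have "\<dots> \<le> norm x * norm (S y)"
      by (rule norm_elem_tensor_le)
    also have "\<dots> \<le> norm x * norm y"
      using norm_blinfun[of S y] mult_right_mono[OF S(3), of "norm y"] by (intro mult_left_mono) auto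
    finally show "\<bar>nuclear_form ps x y\<bar> \<le> norm x * norm y" by (simp add: ps)
    show "norm (abs_tensor xs) - e < eval_sum (nuclear_form ps) xs"
      using S(1) unfolding ps[symmetric] .
  qed
qed

section \<open>Weak-star limits of tensor representations\<close>

text \<open>
  Finitely many functionals map the unit ball to a bounded, hence totally bounded, subset of a
  Euclidean space. One point is taken from each nonempty cell of a grid of mesh \<open>d\<close>.
\<close>

lemma finite_functional_net:
  fixes gs :: "'b::real_normed_vector dual list"
  assumes d: "d > 0"
  obtains N :: "'b set" where "finite N" "N \<subseteq> cball 0 1"
    "\<And>b. norm b \<le> 1 \<Longrightarrow> \<exists>b'\<in>N. \<forall>g\<in>set gs. \<bar>g b - g b'\<bar> \<le> d"
proof -
  define cell where "cell b = map (\<lambda>g. \<lfloor>blinfun_apply g b / d\<rfloor>) gs" for b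
  define K where "K = \<lceil>(\<Sum>g\<leftarrow>gs. norm g) / d\<rceil> + 1"
  have rng: "set (cell b) \<subseteq> {-K..K}" if "norm b \<le> 1" for b
  proof -
    have "\<lfloor>g b / d\<rfloor> \<in> {-K..K}" if g: "g \<in> set gs" for g
    proof -
      have "norm g \<le> (\<Sum>g\<leftarrow>gs. norm g)"
        using g by (intro member_le_sum_list) auto
      then have "\<bar>g b\<bar> \<le> (\<Sum>g\<leftarrow>gs. norm g)"
        using norm_blinfun[of g b] mult_left_mono[OF \<open>norm b \<le> 1\<close>, of "norm g"] by simp
      then have "\<bar>g b / d\<bar> \<le> (\<Sum>g\<leftarrow>gs. norm g) / d"
        using d by (simp add: divide_right_mono)
      then show ?thesis unfolding K_def by (simp; linarith)
    qed
    then show ?thesis by (auto simp: cell_def)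
  qed
  have "cell ` cball 0 1 \<subseteq> {l. set l \<subseteq> {-K..K} \<and> length l = length gs}"
    using rng by (fastforce simp: cell_def)
  then have fin: "finite (cell ` cball 0 1)"
    by (rule finite_subset) (intro finite_lists_length_eq; simp)
  define rep where "rep = inv_into (cball 0 1) cell"
  show thesis
  proof (rule that[of "rep ` cell ` cball 0 1"])
    show "finite (rep ` cell ` cball 0 1)" using fin by simp
    show "rep ` cell ` cball 0 1 \<subseteq> cball 0 1"
      unfolding rep_def by (auto intro: inv_into_into simp del: mem_cball)
    fix b :: 'b assume "norm b \<le> 1"
    then have "b \<in> cball 0 1" by simp
    then have "cell (rep (cell b)) = cell b"
      unfolding rep_def by (intro f_inv_into_f) simp
    then have "\<bar>g b - g (rep (cell b))\<bar> \<le> d" if "g \<in> set gs" for g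
    proof -
      have "\<lfloor>g (rep (cell b)) / d\<rfloor> = \<lfloor>g b / d\<rfloor>"
        using \<open>cell (rep (cell b)) = cell b\<close> that by (simp add: cell_def)
      then have "\<bar>g b / d - g (rep (cell b)) / d\<bar> \<le> 1"
        by linarith
      then show ?thesis using d by (simp add: field_simps flip: diff_divide_distrib)
    qed
    then show "\<exists>b'\<in>rep ` cell ` cball 0 1. \<forall>g\<in>set gs. \<bar>g b - g b'\<bar> \<le> d"
      using \<open>b \<in> cball 0 1\<close> by blast
  qed
qed

text \<open>
  Every summand \<open>a \<otimes> b\<close> is replaced by \<open>(norm b *\<^sub>R a) \<otimes> b'\<close> with \<open>b'\<close> in the net close to \<open>sgn b\<close>,
  and summands with the same \<open>b'\<close> are collected. The number of summands thereby becomes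
  independent of the representation, which makes passing to limits possible.
\<close>

lemma discretize_representation:
  fixes ab :: "('a::real_normed_vector \<times> 'b::real_normed_vector) list" and G :: "'b dual set"
  assumes N: "finite N" and net: "\<And>b. norm b \<le> 1 \<Longrightarrow> \<exists>b'\<in>N. \<forall>g\<in>G. \<bar>blinfun_apply g b - g b'\<bar> \<le> d"
  obtains v :: "'b \<Rightarrow> 'a" where "(\<Sum>b\<in>N. norm (v b)) \<le> proj_cost ab"
    "\<And>(f :: 'a dual) g. g \<in> G \<Longrightarrow>
      \<bar>eval_sum (\<lambda>x y. blinfun_apply f x * blinfun_apply g y) ab - (\<Sum>b\<in>N. f (v b) * g b)\<bar> \<le> d * norm f * proj_cost ab"
proof -
  have "\<exists>v :: 'b \<Rightarrow> 'a. (\<Sum>b\<in>N. norm (v b)) \<le> proj_cost ab \<and> (\<forall>(f :: 'a dual). \<forall>g\<in>G.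
      \<bar>eval_sum (\<lambda>x y. blinfun_apply f x * blinfun_apply g y) ab - (\<Sum>b\<in>N. f (v b) * g b)\<bar> \<le> d * norm f * proj_cost ab)"
  proof (induction ab)
    case Nil
    show ?case by (intro exI[of _ "\<lambda>_. 0"]) simp
  next
    case (Cons p ab)
    obtain a b where p: "p = (a, b)" by (cases p)
    obtain v :: "'b \<Rightarrow> 'a" where v: "(\<Sum>b\<in>N. norm (v b)) \<le> proj_cost ab"
      "\<And>(f :: 'a dual) g. g \<in> G \<Longrightarrow>
        \<bar>eval_sum (\<lambda>x y. blinfun_apply f x * blinfun_apply g y) ab - (\<Sum>b\<in>N. f (v b) * g b)\<bar> \<le> d * norm f * proj_cost ab"
      using Cons.IH by blast
    obtain b' where b': "b' \<in> N" "\<And>g. g \<in> G \<Longrightarrow> \<bar>g (sgn b) - g b'\<bar> \<le> d"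
    proof -
      have "norm (sgn b) \<le> 1" by (simp add: norm_sgn)
      from net[OF this] show thesis using that by blast
    qed
    define v' where "v' c = v c + (if c = b' then norm b *\<^sub>R a else 0)" for c
    have "(\<Sum>c\<in>N. norm (v' c)) \<le> (\<Sum>c\<in>N. norm (v c) + (if c = b' then norm a * norm b else 0))"
    proof (rule sum_mono)
      show "norm (v' c) \<le> norm (v c) + (if c = b' then norm a * norm b else 0)" for c
        using norm_triangle_ineq[of "v c" "norm b *\<^sub>R a"] by (auto simp: v'_def mult.commute)
    qed
    also have "\<dots> = (\<Sum>c\<in>N. norm (v c)) + norm a * norm b"
      using b'(1) N by (simp add: sum.distrib)
    finally have 1: "(\<Sum>c\<in>N. norm (v' c)) \<le> proj_cost (p # ab)"
      using v(1) by (simp add: p)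
    have 2: "\<bar>eval_sum (\<lambda>x y. blinfun_apply f x * blinfun_apply g y) (p # ab) - (\<Sum>c\<in>N. f (v' c) * g c)\<bar> \<le> d * norm f * proj_cost (p # ab)"
      if g: "g \<in> G" for f :: "'a dual" and g
    proof -
      have "(\<Sum>c\<in>N. f (v' c) * g c) = (\<Sum>c\<in>N. f (v c) * g c + (if c = b' then norm b * f a * g b' else 0))"
        by (intro sum.cong) (auto simp: v'_def blinfun.add_right blinfun.scaleR_right algebra_simps)
      also have "\<dots> = (\<Sum>c\<in>N. f (v c) * g c) + norm b * f a * g b'"
        using b'(1) N by (simp add: sum.distrib)
      finally have s: "(\<Sum>c\<in>N. f (v' c) * g c) = (\<Sum>c\<in>N. f (v c) * g c) + norm b * f a * g b'" .
      have "g b = norm b * g (sgn b)"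
        by (cases "b = 0") (auto simp: sgn_div_norm blinfun.scaleR_right)
      then have "f a * g b - norm b * f a * g b' = norm b * f a * (g (sgn b) - g b')"
        by (simp add: algebra_simps)
      moreover have "\<bar>norm b * f a * (g (sgn b) - g b')\<bar> \<le> (norm b * (norm f * norm a)) * d"
        unfolding abs_mult using b'(2)[OF g] norm_blinfun[of f a] by (intro mult_mono) auto
      ultimately have "\<bar>f a * g b - norm b * f a * g b'\<bar> \<le> d * norm f * (norm a * norm b)"
        by (simp add: mult_ac)
      then show ?thesis
        using v(2)[OF g, of f] unfolding s p by (simp add: distrib_left)
    qed
    show ?case
      using 1 2 by blast
  qed
  then show thesis using that by blast
qed

lemma eval_sum_functional_left:
  fixes f :: "'a::real_normed_vector dual"
  shows "eval_sum (\<lambda>x y. blinfun_apply f x * g y) xs = f (\<Sum>(x, y)\<leftarrow>xs. g y *\<^sub>R x)"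
  by (induction xs) (auto simp: blinfun.add_right blinfun.scaleR_right)

text \<open>
  If \<open>P u = 0\<close> and \<open>norm u = 1\<close>, this says that the norms of \<open>z + x \<otimes> y0\<close> cannot stay below any
  number smaller than \<open>\<beta> z + 1\<close> as \<open>x\<close> tends weak-star to \<open>u\<close>, where \<open>z\<close> is the tensor and \<open>\<beta>\<close> is
  a form of finite rank and norm at most \<open>1\<close>. Finite rank is essential for the limit:
  representations are controlled only through finitely many functionals on \<open>Y\<close>, after
  discretization relative to them.
\<close>

lemma weak_star_limit_estimate:
  fixes P :: "'a::banach bidual \<Rightarrow> 'a" and u :: "'a bidual" and F :: "'a filter"
    and xs :: "('a \<times> 'b::banach) list" and ps :: "('a dual \<times> 'b dual) list"
  assumes P: "linear P" "\<And>x. P (canonical_embedding x) = x"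
      "\<And>\<phi>. norm \<phi> = norm (P \<phi>) + norm (\<phi> - canonical_embedding (P \<phi>))"
    and F: "F \<noteq> bot" "\<And>f. (blinfun_apply f \<longlongrightarrow> u f) F"
    and ps: "\<And>x y. \<bar>nuclear_form ps x y\<bar> \<le> norm x * norm y"
    and y0: "norm y0 = 1"
    and c: "\<forall>\<^sub>F x in F. norm (abs_tensor xs + x \<otimes>\<^sub>t y0) < c"
  shows "eval_sum (nuclear_form ps) xs + norm (u - canonical_embedding (P u)) - norm (P u) \<le> c"
proof (rule field_le_epsilon)
  fix e :: real assume e: "e > 0"
  note J = linear_canonical_embedding
  define Q where "Q \<phi> = \<phi> - canonical_embedding (P \<phi>)" for \<phi>
  have Q: "linear Q"
    unfolding Q_def by (intro linear_compose_sub linear_id[unfolded id_def] linear_compose[OF P(1) J, unfolded o_def])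
  have QJ: "Q (canonical_embedding x) = 0" for x
    by (simp add: Q_def P(2))
  have nrm: "norm \<phi> = norm (P \<phi>) + norm (Q \<phi>)" for \<phi>
    unfolding Q_def by (rule P(3))
  have c0: "c > 0"
    using eventually_happens'[OF F(1) c] norm_ge_zero order_le_less_trans by blast
  \<comment> \<open>The mesh \<open>d\<close> is chosen so that the discretization errors, measured by \<open>h\<close> once and by the
    functionals \<open>s\<close> in \<open>ps\<close>, add up to \<open>e\<close>.\<close>
  define K where "K = 1 + (\<Sum>(s, g)\<leftarrow>ps. norm s)"
  have K: "K \<ge> 1"
    unfolding K_def by (simp, induction ps) auto
  define d where "d = e / (c * K)"
  have d: "d > 0" "d * c * K = e"
    using e c0 K by (auto simp: d_def)
  obtain h :: "'b dual" where h: "h y0 = 1" "norm h \<le> 1"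
    using norming_functional[of y0] y0 by metis
  define gs where "gs = h # map snd ps"
  have hgs: "h \<in> set gs" by (simp add: gs_def)
  obtain N where N: "finite N" "N \<subseteq> cball 0 1"
    and net: "\<And>b. norm b \<le> 1 \<Longrightarrow> \<exists>b'\<in>N. \<forall>g\<in>set gs. \<bar>blinfun_apply g b - g b'\<bar> \<le> d"
    using finite_functional_net[OF d(1), of gs] by blast
  have N1: "norm b \<le> 1" if "b \<in> N" for b
    using N(2) that by auto
  define V where "V g = (\<Sum>(x, y)\<leftarrow>xs. blinfun_apply g y *\<^sub>R x)" for g :: "'b dual"
  \<comment> \<open>\<open>v\<close> describes, up to the mesh, a representation of \<open>abs_tensor xs + x \<otimes>\<^sub>t y0\<close> of cost at most
    \<open>c\<close> by elementary tensors \<open>v b \<otimes>\<^sub>t b\<close> with \<open>b\<close> in the fixed finite set \<open>N\<close>.\<close>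
  define R where "R x v \<longleftrightarrow> (\<Sum>b\<in>N. norm (v b)) \<le> c \<and> (\<forall>(f :: 'a dual). \<forall>g\<in>set gs.
      \<bar>blinfun_apply f (V g) + f x * g y0 - (\<Sum>b\<in>N. f (v b) * g b)\<bar> \<le> d * c * norm f)"
    for x and v :: "'b \<Rightarrow> 'a"
  have "\<exists>v. norm (abs_tensor xs + x \<otimes>\<^sub>t y0) < c \<longrightarrow> R x v" for x
  proof (cases "norm (abs_tensor xs + x \<otimes>\<^sub>t y0) < c")
    case True
    define z where "z = abs_tensor xs + x \<otimes>\<^sub>t y0"
    obtain ab where ab: "z = abs_tensor ab" "proj_cost ab < proj_norm z + (c - norm z)"
      using proj_norm_approx[of "c - norm z" z] True by (auto simp: z_def)
    have abc: "proj_cost ab \<le> c" using ab(2) by (simp add: norm_tensor_def)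
    have "abs_tensor ab = abs_tensor (xs @ [(x, y0)])"
      unfolding ab(1)[symmetric] z_def by (simp add: abs_tensor_eq)
    then have rel: "eval_sum A ab = eval_sum A xs + A x y0" if "bilinear A" for A
      using that by (simp add: tensor.abs_eq_iff tensor_rel_def)
    obtain v :: "'b \<Rightarrow> 'a" where v: "(\<Sum>b\<in>N. norm (v b)) \<le> proj_cost ab"
      "\<And>(f :: 'a dual) g. g \<in> set gs \<Longrightarrow>
        \<bar>eval_sum (\<lambda>x y. blinfun_apply f x * blinfun_apply g y) ab - (\<Sum>b\<in>N. f (v b) * g b)\<bar> \<le> d * norm f * proj_cost ab"
      using discretize_representation[OF N(1) net, of ab] by blast
    have "\<bar>f (V g) + f x * g y0 - (\<Sum>b\<in>N. f (v b) * g b)\<bar> \<le> d * c * norm f"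
      if g: "g \<in> set gs" for f :: "'a dual" and g
    proof -
      have "eval_sum (\<lambda>x y. blinfun_apply f x * blinfun_apply g y) ab = f (V g) + f x * g y0"
        unfolding rel[OF bilinear_blinfun_mult] by (simp add: eval_sum_functional_left V_def)
      then have "\<bar>f (V g) + f x * g y0 - (\<Sum>b\<in>N. f (v b) * g b)\<bar> \<le> d * norm f * proj_cost ab"
        using v(2)[OF g, of f] by simp
      also have "\<dots> \<le> d * norm f * c"
        using abc d(1) by (intro mult_left_mono) auto
      finally show ?thesis by (simp add: mult_ac)
    qed
    then show ?thesis using v(1) abc unfolding R_def by (intro exI[of _ v]) auto
  qed simp
  then obtain v where R: "\<And>x. norm (abs_tensor xs + x \<otimes>\<^sub>t y0) < c \<Longrightarrow> R x (v x)"
    by metis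
  have v: "(\<Sum>b\<in>N. norm (v x b)) \<le> c"
    "\<And>(f :: 'a dual) g. g \<in> set gs \<Longrightarrow>
      \<bar>blinfun_apply f (V g) + f x * g y0 - (\<Sum>b\<in>N. f (v x b) * g b)\<bar> \<le> d * c * norm f"
    if "norm (abs_tensor xs + x \<otimes>\<^sub>t y0) < c" for x
    using R[OF that] unfolding R_def by blast+
  have bounded: "\<forall>\<^sub>F x in F. norm (v x b) \<le> c" if "b \<in> N" for b
    using c
  proof eventually_elim
    case (elim x)
    have "norm (v x b) \<le> (\<Sum>b\<in>N. norm (v x b))"
      using that N(1) by (intro member_le_sum) auto
    then show ?case using v(1)[OF elim] by simp
  qed
  obtain F' and \<psi> :: "'b \<Rightarrow> 'a bidual" and r where F': "F' \<noteq> bot" "F' \<le> F"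
    and \<psi>: "\<And>b f. b \<in> N \<Longrightarrow> ((\<lambda>x. blinfun_apply f (v x b)) \<longlongrightarrow> \<psi> b f) F'"
    and r: "\<And>b. b \<in> N \<Longrightarrow> ((\<lambda>x. norm (v x b)) \<longlongrightarrow> r b) F'" "\<And>b. b \<in> N \<Longrightarrow> norm (\<psi> b) \<le> r b"
    by (rule bounded_family_subfilter[of N F v c, OF N(1) F(1) bounded]) (assumption, (rule that; assumption))
  have c': "\<forall>\<^sub>F x in F'. norm (abs_tensor xs + x \<otimes>\<^sub>t y0) < c"
    by (rule filter_leD[OF F'(2) c])
  have u: "(blinfun_apply f \<longlongrightarrow> u f) F'" for f
    by (rule tendsto_mono[OF F'(2) F(2)])
  have "(\<Sum>b\<in>N. norm (\<psi> b)) \<le> (\<Sum>b\<in>N. r b)"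
    by (rule sum_mono) (rule r(2))
  also have "\<dots> \<le> c"
    by (rule tendsto_upperbound[OF tendsto_sum[OF r(1)] _ F'(1)])
      (use c' v(1) in \<open>auto elim: eventually_mono\<close>)
  finally have sum_le: "(\<Sum>b\<in>N. norm (\<psi> b)) \<le> c" .
  \<comment> \<open>\<open>E g\<close> is the error of the limit representation in the coordinate \<open>g\<close>; passing to the limit
    preserves the bound valid along the filter.\<close>
  define E where "E g = canonical_embedding (V g) + g y0 *\<^sub>R u - (\<Sum>b\<in>N. blinfun_apply g b *\<^sub>R \<psi> b)"
    for g :: "'b dual"
  have E: "norm (E g) \<le> d * c" if g: "g \<in> set gs" for g
  proof (rule norm_blinfun_bound)
    show "0 \<le> d * c" using d(1) c0 by simp
    fix f :: "'a dual"
    have "((\<lambda>x. \<bar>f (V g) + f x * g y0 - (\<Sum>b\<in>N. f (v x b) * g b)\<bar>) \<longlongrightarrow>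
        \<bar>f (V g) + u f * g y0 - (\<Sum>b\<in>N. \<psi> b f * g b)\<bar>) F'"
      by (intro tendsto_intros u \<psi>)
    then have "\<bar>f (V g) + u f * g y0 - (\<Sum>b\<in>N. \<psi> b f * g b)\<bar> \<le> d * c * norm f"
      by (rule tendsto_upperbound[OF _ _ F'(1)]) (use c' v(2)[OF _ g] in \<open>auto elim: eventually_mono\<close>)
    then show "norm (E g f) \<le> d * c * norm f"
      by (simp add: E_def blinfun.add_left blinfun.diff_left blinfun.scaleR_left blinfun.sum_left mult.commute)
  qed
  \<comment> \<open>The two components of the limit representation: applying \<open>P\<close> leaves a representation of the
    original tensor up to \<open>P u\<close>, applying \<open>Q\<close> removes that tensor and leaves one of \<open>Q u\<close>.\<close>
  have PE: "P (E g) = V g + g y0 *\<^sub>R P u - (\<Sum>b\<in>N. g b *\<^sub>R P (\<psi> b))" for g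
    by (simp add: E_def linear_diff[OF P(1)] linear_add[OF P(1)] linear_sum[OF P(1)] linear_scale[OF P(1)] P(2))
  have QE: "Q (E g) = g y0 *\<^sub>R Q u - (\<Sum>b\<in>N. g b *\<^sub>R Q (\<psi> b))" for g
    by (simp add: E_def linear_diff[OF Q] linear_add[OF Q] linear_sum[OF Q] linear_scale[OF Q] QJ)
  have form_eq: "(\<Sum>(s, g)\<leftarrow>ps. blinfun_apply s (P (E g))) =
      eval_sum (nuclear_form ps) xs + nuclear_form ps (P u) y0 - (\<Sum>b\<in>N. nuclear_form ps (P (\<psi> b)) b)"
  proof (induction ps)
    case Nil
    show ?case by (induction xs) auto
  next
    case (Cons p ps)
    obtain s g where p: "p = (s, g)" by (cases p)
    have "eval_sum (\<lambda>x y. blinfun_apply s x * g y + nuclear_form ps x y) xs = s (V g) + eval_sum (nuclear_form ps) xs"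
      unfolding V_def by (induction xs) (auto simp: blinfun.add_right blinfun.scaleR_right)
    then show ?case
      using Cons.IH
      by (simp add: p PE blinfun.add_right blinfun.diff_right blinfun.sum_right blinfun.scaleR_right sum.distrib mult.commute)
  qed
  have "(\<Sum>(s, g)\<leftarrow>ps. blinfun_apply s (P (E g))) \<le> (\<Sum>(s, g)\<leftarrow>ps. norm s * (d * c))"
  proof (rule sum_list_mono)
    fix p assume p: "p \<in> set ps"
    obtain s g where sg: "p = (s, g)" by (cases p)
    have "g \<in> set gs"
      using p by (force simp: gs_def sg)
    from E[OF this] have "norm (P (E g)) \<le> d * c"
      using nrm[of "E g"] norm_ge_zero[of "Q (E g)"] by linarith
    then have "s (P (E g)) \<le> norm s * (d * c)"
      using norm_blinfun[of s "P (E g)"] mult_left_mono[of "norm (P (E g))" "d * c" "norm s"] by simp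
    then show "(case p of (s, g) \<Rightarrow> blinfun_apply s (P (E g))) \<le> (case p of (s, g) \<Rightarrow> norm s * (d * c))"
      by (simp add: sg)
  qed
  also have "\<dots> = (K - 1) * (d * c)"
    unfolding K_def by (simp, induction ps) (auto simp: algebra_simps)
  finally have 1: "(\<Sum>(s, g)\<leftarrow>ps. blinfun_apply s (P (E g))) \<le> (K - 1) * (d * c)" .
  have "- nuclear_form ps (P u) y0 \<le> norm (P u)"
    using ps[of "P u" y0] y0 by simp
  moreover have "(\<Sum>b\<in>N. nuclear_form ps (P (\<psi> b)) b) \<le> (\<Sum>b\<in>N. norm (P (\<psi> b)))"
  proof (rule sum_mono)
    fix b assume "b \<in> N"
    then show "nuclear_form ps (P (\<psi> b)) b \<le> norm (P (\<psi> b))"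
      using ps[of "P (\<psi> b)" b] mult_left_mono[OF N1[of b], of "norm (P (\<psi> b))"] by simp
  qed
  ultimately have 2: "eval_sum (nuclear_form ps) xs \<le> (\<Sum>b\<in>N. norm (P (\<psi> b))) + norm (P u) + (K - 1) * (d * c)"
    using form_eq 1 by linarith
  have "norm (Q u) \<le> norm (Q (E h)) + norm (\<Sum>b\<in>N. h b *\<^sub>R Q (\<psi> b))"
    using norm_triangle_ineq[of "Q (E h)" "\<Sum>b\<in>N. h b *\<^sub>R Q (\<psi> b)"] by (simp add: QE h(1))
  also have "norm (Q (E h)) \<le> d * c"
    using E[OF hgs] nrm[of "E h"] norm_ge_zero[of "P (E h)"] by linarith
  also have "norm (\<Sum>b\<in>N. h b *\<^sub>R Q (\<psi> b)) \<le> (\<Sum>b\<in>N. norm (Q (\<psi> b)))"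
  proof (rule sum_norm_le)
    fix b assume "b \<in> N"
    then have "\<bar>h b\<bar> \<le> 1"
      using abs_functional_le_norm[OF h(2), of b] N1[of b] by linarith
    then show "norm (h b *\<^sub>R Q (\<psi> b)) \<le> norm (Q (\<psi> b))"
      by (simp add: mult_left_le_one_le)
  qed
  finally have 3: "norm (Q u) \<le> d * c + (\<Sum>b\<in>N. norm (Q (\<psi> b)))" by simp
  have "(\<Sum>b\<in>N. norm (P (\<psi> b))) + (\<Sum>b\<in>N. norm (Q (\<psi> b))) \<le> c"
    using sum_le by (simp add: sum.distrib[symmetric] nrm[symmetric])
  then have "eval_sum (nuclear_form ps) xs + norm (Q u) - norm (P u) \<le> c + (d * c + (K - 1) * (d * c))"
    using 2 3 by linarith
  also have "d * c + (K - 1) * (d * c) = e"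
    using d(2) by (simp add: algebra_simps)
  finally show "eval_sum (nuclear_form ps) xs + norm (u - canonical_embedding (P u)) - norm (P u) \<le> c + e"
    by (simp add: Q_def)
qed

section \<open>The Daugavet property of the projective tensor product\<close>

lemma functional_projective_tensor_bound:
  fixes G :: "('a::banach, 'b::banach) projective_tensor dual"
  assumes c: "c \<ge> 0" and le: "\<And>x y. \<bar>G (to_completion (x \<otimes>\<^sub>t y))\<bar> \<le> c * (norm x * norm y)"
  shows "norm G \<le> c"
proof (rule norm_blinfun_bound[OF c])
  have alg: "\<bar>G (to_completion z)\<bar> \<le> c * norm z" for z :: "('a, 'b) tensor"
  proof (rule field_le_epsilon)
    fix e :: real assume "e > 0"
    define d where "d = e / (c + 1)"
    have d: "d > 0" "c * d \<le> e"
      using \<open>e > 0\<close> c by (auto simp: d_def field_simps)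
    obtain xs where xs: "z = abs_tensor xs" "proj_cost xs < proj_norm z + d"
      using proj_norm_approx[OF d(1)] by blast
    have "\<bar>G (to_completion (abs_tensor xs))\<bar> \<le> c * proj_cost xs"
      unfolding abs_tensor_eq
    proof (induction xs)
      case Nil
      show ?case by (simp add: linear_0[OF linear_to_completion])
    next
      case (Cons p xs)
      obtain x y where p: "p = (x, y)" by (cases p)
      show ?case
        using Cons.IH le[of x y] by (simp add: p linear_add[OF linear_to_completion] blinfun.add_right algebra_simps)
    qed
    also have "\<dots> \<le> c * (proj_norm z + d)"
      using xs(2) c by (intro mult_left_mono) auto
    finally show "\<bar>G (to_completion z)\<bar> \<le> c * norm z + e"
      using d(2) by (simp add: xs(1) norm_tensor_def algebra_simps)
  qed
  fix w :: "('a, 'b) projective_tensor"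
  show "norm (G w) \<le> c * norm w"
  proof (rule field_le_epsilon)
    fix e :: real assume "e > 0"
    define d where "d = e / (norm G + c + 1)"
    have pos: "norm G + c + 1 > 0"
      using c by (simp add: add_nonneg_pos)
    then have "d > 0" "(norm G + c + 1) * d = e"
      using \<open>e > 0\<close> by (simp_all add: d_def)
    then have d: "d > 0" "(norm G + c) * d \<le> e"
      by (simp_all add: distrib_right)
    obtain z where z: "dist (to_completion z) w < d"
      by (rule completion_approx[OF d(1)])
    let ?r = "w - to_completion z"
    have r: "norm ?r \<le> d"
      using z by (simp add: dist_norm norm_minus_commute)
    have "\<bar>G w\<bar> \<le> \<bar>G (to_completion z)\<bar> + \<bar>G ?r\<bar>"
      by (simp add: blinfun.diff_right)
    also have "\<bar>G (to_completion z)\<bar> \<le> c * norm (to_completion z)"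
      using alg by simp
    also have "norm (to_completion z) \<le> norm w + norm ?r"
      using norm_triangle_ineq4[of w ?r] by simp
    also have "\<bar>G ?r\<bar> \<le> norm G * norm ?r"
      using norm_blinfun[of G ?r] by simp
    finally have "\<bar>G w\<bar> \<le> c * (norm w + norm ?r) + norm G * norm ?r"
      using c by (simp add: mult_left_mono)
    also have "\<dots> = c * norm w + (norm G + c) * norm ?r"
      by (simp add: algebra_simps)
    also have "(norm G + c) * norm ?r \<le> (norm G + c) * d"
      using r c by (intro mult_left_mono) auto
    finally show "norm (G w) \<le> c * norm w + e"
      using d(2) by simp
  qed
qed

text \<open>
  The elementary tensors of unit vectors are norming for functionals on the completed tensor
  product; \<open>a0\<close> and \<open>b0\<close> only ensure that unit vectors exist.
\<close>

lemma functional_projective_tensor_norming: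
  fixes G :: "('a::banach, 'b::banach) projective_tensor dual" and a0 :: 'a and b0 :: 'b
  assumes nz: "a0 \<noteq> 0" "b0 \<noteq> 0" and e: "e > 0"
  obtains x y where "norm x = 1" "norm y = 1" "norm G - e < G (to_completion (x \<otimes>\<^sub>t y))"
proof -
  have "\<exists>x y. (norm G - e) * (norm x * norm y) < \<bar>G (to_completion (x \<otimes>\<^sub>t y))\<bar>"
  proof (cases "norm G - e \<ge> 0")
    case True
    then show ?thesis
      using functional_projective_tensor_bound[OF True, of G] e by (meson diff_less_eq less_add_same_cancel1 not_le)
  next
    case False
    then have "(norm G - e) * (norm a0 * norm b0) < 0"
      using nz by (simp add: mult_less_0_iff)
    then show ?thesis using abs_ge_zero order_less_le_trans by blast
  qed
  then obtain x y where xy: "(norm G - e) * (norm x * norm y) < \<bar>G (to_completion (x \<otimes>\<^sub>t y))\<bar>"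
    by blast
  define g where "g = G (to_completion (x \<otimes>\<^sub>t y))"
  have nxy: "x \<noteq> 0" "y \<noteq> 0"
    using xy by (auto simp: bilinear_lzero[OF bilinear_elem_tensor] bilinear_rzero[OF bilinear_elem_tensor]
        linear_0[OF linear_to_completion])
  \<comment> \<open>Rescaling and a change of sign make the value positive.\<close>
  define s where "s = (if g \<ge> 0 then 1 else -1 :: real)"
  define x' where "x' = (s / norm x) *\<^sub>R x"
  define y' where "y' = (1 / norm y) *\<^sub>R y"
  have "G (to_completion (x' \<otimes>\<^sub>t y')) = \<bar>g\<bar> / (norm x * norm y)"
    by (simp add: x'_def y'_def bilinear_lmul[OF bilinear_elem_tensor] bilinear_rmul[OF bilinear_elem_tensor]
        linear_scale[OF linear_to_completion] blinfun.scaleR_right flip: g_def) (simp add: s_def)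
  moreover have "norm G - e < \<bar>g\<bar> / (norm x * norm y)"
    using xy nxy by (simp add: g_def pos_less_divide_eq)
  ultimately show thesis
    using that[of x' y'] nxy by (simp add: x'_def y'_def s_def)
qed

theorem theorem4p2:
  assumes "L_embedded TYPE('a::banach)"
    and "Daugavet_property TYPE('a)"
    and "has_density_character TYPE('a) omega_1"
    and "\<exists>y :: 'b::banach. y \<noteq> 0"
    and "metric_approximation_property TYPE('a bidual) \<or> metric_approximation_property TYPE('b)"
  shows "Daugavet_property TYPE(('a, 'b) projective_tensor)"
proof (rule Daugavet_property_if_slices)
  fix G :: "('a, 'b) projective_tensor dual" and w :: "('a, 'b) projective_tensor" and e :: real
  assume e: "e > 0"
  define d where "d = e / 5"
  have d: "d > 0" "e = 5 * d" using e by (auto simp: d_def)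
  obtain P :: "'a bidual \<Rightarrow> 'a" where P: "linear P" "\<And>x. P (canonical_embedding x) = x"
    "\<And>\<phi>. norm \<phi> = norm (P \<phi>) + norm (\<phi> - canonical_embedding (P \<phi>))"
    by (rule L_embedded_projection[OF assms(1)]) (rule that; assumption)
  obtain z0 where z0: "dist (to_completion z0) w < d"
    by (rule completion_approx[OF d(1)])
  obtain xs where xs: "z0 = abs_tensor xs"
    by (rule abs_tensor_exhaust)
  have "\<exists>ps :: ('a dual \<times> 'b dual) list. (\<forall>x y. \<bar>nuclear_form ps x y\<bar> \<le> norm x * norm y) \<and>
      norm z0 - d < eval_sum (nuclear_form ps) xs"
    using assms(5)
  proof
    assume "metric_approximation_property TYPE('a bidual)"
    then obtain F :: "('a bidual \<Rightarrow>\<^sub>L 'a bidual) filter" where F: "contractive_approximation F"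
      by (rule contractive_approximation_if_MAP)
    have "norm (P \<phi>) \<le> norm \<phi>" for \<phi>
      using P(3)[of \<phi>] by simp
    from contractive_approximation_below_bidual[OF P(1,2) this F]
    obtain F' :: "('a \<Rightarrow>\<^sub>L 'a) filter" where "contractive_approximation F'" by blast
    from norming_nuclear_form_left[OF this d(1), of xs] show ?thesis
      unfolding xs by metis
  next
    assume "metric_approximation_property TYPE('b)"
    then obtain F :: "('b \<Rightarrow>\<^sub>L 'b) filter" where F: "contractive_approximation F"
      by (rule contractive_approximation_if_MAP)
    from norming_nuclear_form_right[OF F d(1), of xs] show ?thesis
      unfolding xs by metis
  qed
  then obtain ps :: "('a dual \<times> 'b dual) list" where ps: "\<And>x y. \<bar>nuclear_form ps x y\<bar> \<le> norm x * norm y"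
    "norm z0 - d < eval_sum (nuclear_form ps) xs"
    by blast
  obtain a0 :: 'a where a0: "a0 \<noteq> 0"
    using nontrivial_if_density_omega_1[OF assms(3)] by blast
  obtain b0 :: 'b where b0: "b0 \<noteq> 0" using assms(4) by blast
  obtain x0 y0 where x0: "norm x0 = 1" and y0: "norm y0 = 1"
    and G: "norm G - d < G (to_completion (x0 \<otimes>\<^sub>t y0))"
    by (rule functional_projective_tensor_norming[OF a0 b0 d(1)])
  have bc: "bounded_linear (to_completion :: ('a, 'b) tensor \<Rightarrow> _)"
    by (rule bounded_linear_intro[where K = 1])
      (simp_all add: linear_add[OF linear_to_completion] linear_scale[OF linear_to_completion])
  define \<Psi> where "\<Psi> = G o\<^sub>L Blinfun to_completion"
  have \<Psi>: "\<Psi> z = G (to_completion z)" for z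
    by (simp add: \<Psi>_def bounded_linear_Blinfun_apply[OF bc])
  obtain f :: "'a dual" where f: "\<And>x. f x = \<Psi> (x \<otimes>\<^sub>t y0)"
    using functional_tensor_left[of \<Psi> y0] by metis
  have f_norm: "norm G - d < norm f"
    using G norm_blinfun[of f x0] x0 by (simp add: f \<Psi>)
  obtain u :: "'a bidual" where u: "norm u \<le> 1" "u f = norm f"
    "\<And>x. norm x + 1 - d \<le> norm (canonical_embedding x + u)"
    by (rule almost_L_orthogonal[OF assms(2,3) d(1), of f]) (rule that; assumption)
  have Lo: "norm (P u) + 1 - d \<le> norm (u - canonical_embedding (P u))"
    using u(3)[of "- P u"] by (simp add: linear_neg[OF linear_canonical_embedding])
  obtain F :: "'a filter" where F: "F \<noteq> bot" "\<forall>\<^sub>F x in F. norm x \<le> 1"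
    "\<And>f. (blinfun_apply f \<longlongrightarrow> u f) F"
    by (rule Goldstine[OF u(1)]) (rule that; assumption)
  have "\<not> (\<forall>\<^sub>F x in F. norm (abs_tensor xs + x \<otimes>\<^sub>t y0) < norm z0 + 1 - 2 * d)"
  proof
    assume "\<forall>\<^sub>F x in F. norm (abs_tensor xs + x \<otimes>\<^sub>t y0) < norm z0 + 1 - 2 * d"
    from weak_star_limit_estimate[OF P F(1,3) ps(1) y0 this] show False
      using ps(2) Lo by linarith
  qed
  then have "\<exists>\<^sub>F x in F. norm z0 + 1 - 2 * d \<le> norm (z0 + x \<otimes>\<^sub>t y0)"
    by (simp add: frequently_def xs not_le)
  moreover have "\<forall>\<^sub>F x in F. norm f - d < f x"
    using F(3)[of f] u(2) d(1) by (intro order_tendstoD(1)) auto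
  ultimately obtain x where x: "norm z0 + 1 - 2 * d \<le> norm (z0 + x \<otimes>\<^sub>t y0)" "norm f - d < f x" "norm x \<le> 1"
    using F(2) by (metis (mono_tags, lifting) eventually_conj frequently_eventually_frequently frequently_ex)
  define t where "t = to_completion (x \<otimes>\<^sub>t y0)"
  have "norm t \<le> 1"
    using norm_elem_tensor_le[of x y0] x(3) y0 by (simp add: t_def)
  moreover have "norm G - e \<le> G t"
    using x(2) f_norm d by (simp add: t_def f \<Psi>)
  moreover have "norm w + 1 - e \<le> norm (w + t)"
  proof -
    have "norm (z0 + x \<otimes>\<^sub>t y0) = norm (to_completion z0 + t)"
      by (simp add: t_def flip: linear_add[OF linear_to_completion])
    also have "\<dots> \<le> norm (w + t) + norm (to_completion z0 - w)"
      using norm_triangle_ineq[of "w + t" "to_completion z0 - w"] by (simp add: algebra_simps)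
    finally have "norm (z0 + x \<otimes>\<^sub>t y0) \<le> norm (w + t) + d"
      using z0 by (simp add: dist_norm)
    moreover have "norm w \<le> norm z0 + d"
      using z0 norm_triangle_ineq2[of w "to_completion z0"] by (simp add: dist_norm norm_minus_commute)
    ultimately show ?thesis using x(1) d by simp
  qed
  ultimately show "\<exists>t. norm t \<le> 1 \<and> norm G - e \<le> G t \<and> norm w + 1 - e \<le> norm (w + t)"
    by blast
qed

end
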